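(* Let $M$ be a compact complex manifold with RC-positive tangent bundle, and let $(N,h)$ be a Hermitian manifold with non-positive holomorphic bisectional curvature. Then any holomorphic map from $M$ to $N$ is a constant map.
   Context: Complex manifolds are connected (usual convention). A Hermitian manifold is a complex manifold with a smooth Hermitian metric on its holomorphic tangent bundle. For a Hermitian manifold $(X,g)$, the Chern curvature tensor has components $R_{i\bar jk\bar\ell}=-\frac{\partial^2g_{k\bar\ell}}{\partial z^i\partial\bar z^j}+g^{p\bar q}\frac{\partial g_{k\bar q}}{\partial z^i}\frac{\partial g_{p\bar\ell}}{\partial\bar z^j}$, and $R(u,\bar u,v,\bar v)=R_{i\bar jk\bar\ell}u^i\bar u^jv^k\bar v^\ell$ for $(1,0)$-vectors $u,v$. $M$ has RC-positive tangent bundle if it admits a smooth Hermitian metric $g$ such that for every $q\in M$ and every nonzero $v\in T_qM$ there exists some nonzero $u\in T_qM$ (possibly depending on $v$) with $R^g(u,\bar u,v,\bar v)>0$. $(N,h)$ has non-positive holomorphic bisectional curvature if $R^h(u,\bar u,v,\bar v)\le0$ for all $q\in N$ and all $u,v\in T_qN$. *)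

theory Defs
  imports "HOL-Analysis.Analysis"
begin

section \<open>Holomorphic and smooth maps on complex Euclidean space\<close>

text \<open>Holomorphic in several variables: complex differentiable, i.e. the real Frechet derivative
  exists at every point and is complex linear. Only used for open \<open>S\<close>.\<close>

definition mv_holomorphic_on :: "(complex^'m \<Rightarrow> complex^'n) \<Rightarrow> (complex^'m) set \<Rightarrow> bool" where
  "mv_holomorphic_on F S \<longleftrightarrow>
     (\<forall>z\<in>S. \<exists>F'. (F has_derivative F') (at z) \<and> Vector_Spaces.linear (*s) (*s) F')"

text \<open>The class C-k on an open set, in the real sense: all iterated directional derivatives up to
  order \<open>k\<close> exist and are continuous.\<close>

primrec Ck_on :: "nat \<Rightarrow> ('a::real_normed_vector \<Rightarrow> 'b::real_normed_vector) \<Rightarrow> 'a set \<Rightarrow> bool" where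
  "Ck_on 0 F S \<longleftrightarrow> continuous_on S F"
| "Ck_on (Suc k) F S \<longleftrightarrow>
     (\<forall>x\<in>S. F differentiable (at x)) \<and>
     (\<forall>v. Ck_on k (\<lambda>x. frechet_derivative F (at x) v) S)"

definition smooth_on :: "('a::real_normed_vector \<Rightarrow> 'b::real_normed_vector) \<Rightarrow> 'a set \<Rightarrow> bool" where
  "smooth_on F S \<longleftrightarrow> (\<forall>k. Ck_on k F S)"

text \<open>Wirtinger derivatives with respect to the \<open>i\<close>-th coordinate and its conjugate:
  half of (d/dx - i d/dy), respectively half of (d/dx + i d/dy).\<close>

definition dz :: "'n \<Rightarrow> (complex^'n \<Rightarrow> complex) \<Rightarrow> complex^'n \<Rightarrow> complex" where
  "dz i F z = (frechet_derivative F (at z) (axis i 1)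
               - \<i> * frechet_derivative F (at z) (axis i \<i>)) / 2"

definition dzbar :: "'n \<Rightarrow> (complex^'n \<Rightarrow> complex) \<Rightarrow> complex^'n \<Rightarrow> complex" where
  "dzbar i F z = (frechet_derivative F (at z) (axis i 1)
                  + \<i> * frechet_derivative F (at z) (axis i \<i>)) / 2"


section \<open>Complex manifolds\<close>

text \<open>A chart is a pair of its domain and its coordinate map; the values of the coordinate map
  outside the domain are irrelevant.\<close>

type_synonym ('a, 'n) chart = "'a set \<times> ('a \<Rightarrow> complex^'n)"

abbreviation chart_dom :: "('a, 'n::finite) chart \<Rightarrow> 'a set" where
  "chart_dom c \<equiv> fst c"

abbreviation chart_map :: "('a, 'n::finite) chart \<Rightarrow> 'a \<Rightarrow> complex^'n" where
  "chart_map c \<equiv> snd c"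

abbreviation chart_ran :: "('a, 'n::finite) chart \<Rightarrow> (complex^'n) set" where
  "chart_ran c \<equiv> chart_map c ` chart_dom c"

definition chart_inv :: "('a, 'n::finite) chart \<Rightarrow> complex^'n \<Rightarrow> 'a" where
  "chart_inv c = inv_into (chart_dom c) (chart_map c)"

definition is_chart :: "'a topology \<Rightarrow> ('a, 'n::finite) chart \<Rightarrow> bool" where
  "is_chart X c \<longleftrightarrow>
     openin X (chart_dom c) \<and> open (chart_ran c) \<and>
     homeomorphic_map (subtopology X (chart_dom c)) (top_of_set (chart_ran c)) (chart_map c)"

definition transition :: "('a, 'n::finite) chart \<Rightarrow> ('a, 'n::finite) chart \<Rightarrow> complex^'n \<Rightarrow> complex^'n" where
  "transition c d = chart_map d \<circ> chart_inv c"

text \<open>The complex structure is given by a holomorphic atlas, which need not be maximal.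
  Manifolds are connected.\<close>

definition complex_manifold :: "'a topology \<Rightarrow> ('a, 'n::finite) chart set \<Rightarrow> bool" where
  "complex_manifold X \<A> \<longleftrightarrow>
     Hausdorff_space X \<and> second_countable X \<and> connected_space X \<and>
     (\<forall>c\<in>\<A>. is_chart X c) \<and> (\<Union>c\<in>\<A>. chart_dom c) = topspace X \<and>
     (\<forall>c\<in>\<A>. \<forall>d\<in>\<A>.
        mv_holomorphic_on (transition c d) (chart_map c ` (chart_dom c \<inter> chart_dom d)))"

definition holomorphic_map ::
  "'a topology \<Rightarrow> ('a, 'm::finite) chart set \<Rightarrow> 'b topology \<Rightarrow> ('b, 'n::finite) chart set \<Rightarrow> ('a \<Rightarrow> 'b) \<Rightarrow> bool" where
  "holomorphic_map X \<A> Y \<B> f \<longleftrightarrow>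
     continuous_map X Y f \<and>
     (\<forall>c\<in>\<A>. \<forall>d\<in>\<B>.
        mv_holomorphic_on (chart_map d \<circ> f \<circ> chart_inv c)
          (chart_map c ` {p \<in> chart_dom c. f p \<in> chart_dom d}))"


section \<open>Holomorphic tangent vectors and Hermitian metrics\<close>

text \<open>A (1,0)-vector at \<open>q\<close> is a family of component vectors, one for each chart around \<open>q\<close>,
  transforming by the derivatives of the transition maps. The value at everything that is not a
  chart around \<open>q\<close> is normalised to 0, so that vectors are equal iff their components are. The
  vector space operations are pointwise.\<close>

type_synonym ('a, 'n) tvec = "('a, 'n) chart \<Rightarrow> complex^'n"

definition hol_tangent_space :: "('a, 'n::finite) chart set \<Rightarrow> 'a \<Rightarrow> ('a, 'n::finite) tvec set" where
  "hol_tangent_space \<A> q = {v.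
     (\<forall>c\<in>\<A>. \<forall>d\<in>\<A>. q \<in> chart_dom c \<longrightarrow> q \<in> chart_dom d \<longrightarrow>
        v d = frechet_derivative (transition c d) (at (chart_map c q)) (v c)) \<and>
     (\<forall>c. \<not> (c \<in> \<A> \<and> q \<in> chart_dom c) \<longrightarrow> v c = 0)}"

text \<open>The coordinate vector \<open>\<partial>/\<partial>z\<^sup>k\<close> of the chart \<open>c\<close> at \<open>q\<close>.\<close>

definition coord_vec :: "('a, 'n::finite) chart set \<Rightarrow> ('a, 'n::finite) chart \<Rightarrow> 'a \<Rightarrow> 'n \<Rightarrow> ('a, 'n::finite) tvec" where
  "coord_vec \<A> c q k = (\<lambda>d.
     if d \<in> \<A> \<and> q \<in> chart_dom d
     then frechet_derivative (transition c d) (at (chart_map c q)) (axis k 1) else 0)"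

type_synonym ('a, 'n) metric = "'a \<Rightarrow> ('a, 'n) tvec \<Rightarrow> ('a, 'n) tvec \<Rightarrow> complex"

text \<open>The local matrix of a metric: its \<open>(k, l)\<close> entry is the component with indices
  \<open>k\<close> and l-bar, as a function of the coordinates.\<close>

definition metric_matrix ::
  "('a, 'n::finite) chart set \<Rightarrow> ('a, 'n::finite) metric \<Rightarrow> ('a, 'n::finite) chart \<Rightarrow> complex^'n \<Rightarrow> complex^'n^'n" where
  "metric_matrix \<A> g c z =
     (let q = chart_inv c z in \<chi> k l. g q (coord_vec \<A> c q k) (coord_vec \<A> c q l))"

definition hermitian_metric ::
  "'a topology \<Rightarrow> ('a, 'n::finite) chart set \<Rightarrow> ('a, 'n::finite) metric \<Rightarrow> bool" where
  "hermitian_metric X \<A> g \<longleftrightarrow>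
     (\<forall>q\<in>topspace X.
        (\<forall>u\<in>hol_tangent_space \<A> q. \<forall>v\<in>hol_tangent_space \<A> q. \<forall>w\<in>hol_tangent_space \<A> q. \<forall>a.
           g q (\<lambda>c. a *s u c + v c) w = a * g q u w + g q v w) \<and>
        (\<forall>u\<in>hol_tangent_space \<A> q. \<forall>v\<in>hol_tangent_space \<A> q. g q v u = cnj (g q u v)) \<and>
        (\<forall>u\<in>hol_tangent_space \<A> q. u \<noteq> (\<lambda>c. 0) \<longrightarrow> Re (g q u u) > 0)) \<and>
     (\<forall>c\<in>\<A>. \<forall>k l. smooth_on (\<lambda>z. metric_matrix \<A> g c z $ k $ l) (chart_ran c))"


section \<open>Chern curvature\<close>

text \<open>Component of the Chern curvature with indices \<open>i\<close>, j-bar, \<open>k\<close>, l-bar of a metric with local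
  matrix \<open>G\<close>. The inverse metric with indices \<open>p\<close>, q-bar is normalised by: the sum over \<open>q\<close> of
  its product with \<open>G $ k $ q\<close> is the Kronecker delta of \<open>k\<close> and \<open>p\<close>. So it is the \<open>(q, p)\<close> entry
  of the inverse of \<open>G\<close>.\<close>

definition chern_component ::
  "(complex^'n \<Rightarrow> complex^'n^'n) \<Rightarrow> complex^'n \<Rightarrow> 'n \<Rightarrow> 'n \<Rightarrow> 'n \<Rightarrow> 'n \<Rightarrow> complex" where
  "chern_component G z i j k l =
     - dz i (\<lambda>y. dzbar j (\<lambda>x. G x $ k $ l) y) z
     + (\<Sum>p\<in>UNIV. \<Sum>q\<in>UNIV. matrix_inv (G z) $ q $ p *
          dz i (\<lambda>x. G x $ k $ q) z * dzbar j (\<lambda>x. G x $ p $ l) z)"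

text \<open>\<open>R(u, u-bar, v, v-bar)\<close> at \<open>q\<close>, computed in the chart \<open>c\<close> around \<open>q\<close>. As the Chern curvature
  is a tensor, the value is the same for all charts around \<open>q\<close>.\<close>

definition chern_curvature ::
  "('a, 'n::finite) chart set \<Rightarrow> ('a, 'n::finite) metric \<Rightarrow> ('a, 'n::finite) chart \<Rightarrow> 'a \<Rightarrow>
   ('a, 'n::finite) tvec \<Rightarrow> ('a, 'n::finite) tvec \<Rightarrow> complex" where
  "chern_curvature \<A> g c q u v =
     (\<Sum>i\<in>UNIV. \<Sum>j\<in>UNIV. \<Sum>k\<in>UNIV. \<Sum>l\<in>UNIV.
        chern_component (metric_matrix \<A> g c) (chart_map c q) i j k l *
        u c $ i * cnj (u c $ j) * v c $ k * cnj (v c $ l))"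

text \<open>For a Hermitian metric \<open>R(u, u-bar, v, v-bar)\<close> is a real number, so sign conditions on it are
  stated for the real part.\<close>

definition RC_positive_tangent_bundle :: "'a topology \<Rightarrow> ('a, 'n::finite) chart set \<Rightarrow> bool" where
  "RC_positive_tangent_bundle X \<A> \<longleftrightarrow>
     (\<exists>g. hermitian_metric X \<A> g \<and>
        (\<forall>c\<in>\<A>. \<forall>q\<in>chart_dom c. \<forall>v\<in>hol_tangent_space \<A> q. v \<noteq> (\<lambda>d. 0) \<longrightarrow>
           (\<exists>u\<in>hol_tangent_space \<A> q. u \<noteq> (\<lambda>d. 0) \<and> Re (chern_curvature \<A> g c q u v) > 0)))"

definition nonpos_bisectional_curvature :: "('a, 'n::finite) chart set \<Rightarrow> ('a, 'n::finite) metric \<Rightarrow> bool" where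
  "nonpos_bisectional_curvature \<A> h \<longleftrightarrow>
     (\<forall>c\<in>\<A>. \<forall>q\<in>chart_dom c. \<forall>u\<in>hol_tangent_space \<A> q. \<forall>v\<in>hol_tangent_space \<A> q.
        Re (chern_curvature \<A> h c q u v) \<le> 0)"

end

theory Submission
  imports Defs "HOL-Complex_Analysis.Cauchy_Integral_Formula"
begin

text \<open>Over all \<open>(1,0)\<close>-vectors \<open>v \<noteq> 0\<close> of the compact manifold \<open>M\<close>, the ratio of \<open>h(df v, df v)\<close> to
  \<open>g(v, v)\<close> attains a maximum \<open>m\<close>, say at \<open>v\<close> over \<open>q\<close>. For \<open>u\<close> tangent at \<open>q\<close>, extend \<open>v\<close> along the
  complex line \<open>z + t u\<close> in a chart to the affine field \<open>V(t) = v + t b\<close>, with \<open>b\<close> chosen such that the Chern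
  covariant derivative of \<open>V\<close> along \<open>u\<close> vanishes at \<open>t = 0\<close>. The function \<open>h(df V, df V) - m g(V, V)\<close> of \<open>t\<close> is
  nonpositive and vanishes at \<open>t = 0\<close>, so its Laplacian there is nonpositive. Up to the factor 4 this Laplacian is
  \<open>- R\<^sup>h(df u, df v) + m R\<^sup>g(u, v)\<close> plus the squared norm of a covariant derivative in \<open>N\<close>; hence
  \<open>m R\<^sup>g(u, v) \<le> R\<^sup>h(df u, df v) \<le> 0\<close>. Choosing \<open>u\<close> with \<open>R\<^sup>g(u, v) > 0\<close> gives \<open>m \<le> 0\<close>, so \<open>df = 0\<close>
  and \<open>f\<close> is locally constant on the connected space \<open>M\<close>.\<close>

section \<open>Second-order jets of curves\<close>

text \<open>For \<open>m > 0\<close> the squared covariant derivative of \<open>V\<close> enters the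
  Laplacian of \<open>- m g(V, V)\<close> with the wrong sign; the choice of \<open>b\<close> makes
  it vanish. Its counterpart in \<open>N\<close> has the good sign and is dropped, so nothing has to
  be known about the derivative of the pushed-forward field. The Laplacian is the sum of the second
  derivatives along the real lines \<open>t = s\<close> and \<open>t = s * \<i>\<close>, and the
  one-variable second derivative test is applied on each line. \<open>mv_holomorphic_on\<close>
  gives one derivative at each point and no continuity of it, while \<open>df V\<close> has to be
  differentiated twice in \<open>t\<close>. The missing regularity comes from Cauchy estimates on
  complex lines: the derivative is a locally uniform limit of difference quotients. Tangent vectors
  are families of components, and the tangent bundle carries no topology. The maximum is therefore
  taken over finitely many closed coordinate balls times the Euclidean unit sphere; this reaches all
  nonzero vectors because the ratio is homogeneous of degree 0 and independent of the
  charts.\<close>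

text \<open>\<open>p\<close> and \<open>q\<close> are the first and second derivatives of
  \<open>f\<close> at 0. As a relation it admits closure rules that compute both values and prove
  their existence at the same time.\<close>

definition jet2 :: "(real \<Rightarrow> 'a::real_normed_vector) \<Rightarrow> 'a \<Rightarrow> 'a \<Rightarrow> bool" where
  "jet2 f p q \<longleftrightarrow> (\<exists>f'. (\<forall>\<^sub>F s in nhds 0. (f has_vector_derivative f' s) (at s)) \<and> f' 0 = p \<and>
     (f' has_vector_derivative q) (at 0))"

lemma jet2_const: "jet2 (\<lambda>s. c) 0 0"
  unfolding jet2_def by (intro exI[of _ "\<lambda>s. 0"]) auto

lemma jet2_add:
  assumes "jet2 f p q" "jet2 g p' q'"
  shows "jet2 (\<lambda>s. f s + g s) (p + p') (q + q')"
proof -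
  obtain f' g' where
    f: "\<forall>\<^sub>F s in nhds 0. (f has_vector_derivative f' s) (at s)" "f' 0 = p" "(f' has_vector_derivative q) (at 0)" and
    g: "\<forall>\<^sub>F s in nhds 0. (g has_vector_derivative g' s) (at s)" "g' 0 = p'" "(g' has_vector_derivative q') (at 0)"
    using assms unfolding jet2_def by blast
  show ?thesis
    unfolding jet2_def
  proof (intro exI[of _ "\<lambda>s. f' s + g' s"] conjI)
    show "\<forall>\<^sub>F s in nhds 0. ((\<lambda>s. f s + g s) has_vector_derivative f' s + g' s) (at s)"
      using f(1) g(1) by eventually_elim (rule has_vector_derivative_add)
  qed (use f g in \<open>auto intro!: has_vector_derivative_add\<close>)
qed

lemma jet2_sum:
  assumes "\<And>i. i \<in> I \<Longrightarrow> jet2 (f i) (p i) (q i)"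
  shows "jet2 (\<lambda>s. \<Sum>i\<in>I. f i s) (\<Sum>i\<in>I. p i) (\<Sum>i\<in>I. q i)"
  using assms by (induction I rule: infinite_finite_induct) (auto intro: jet2_add jet2_const)

lemma jet2_bounded_linear:
  assumes "bounded_linear L" "jet2 f p q"
  shows "jet2 (\<lambda>s. L (f s)) (L p) (L q)"
proof -
  obtain f' where
    f: "\<forall>\<^sub>F s in nhds 0. (f has_vector_derivative f' s) (at s)" "f' 0 = p" "(f' has_vector_derivative q) (at 0)"
    using assms unfolding jet2_def by blast
  show ?thesis
    unfolding jet2_def
  proof (intro exI[of _ "\<lambda>s. L (f' s)"] conjI)
    show "\<forall>\<^sub>F s in nhds 0. ((\<lambda>s. L (f s)) has_vector_derivative L (f' s)) (at s)"
      using f(1) by eventually_elim (rule bounded_linear.has_vector_derivative[OF assms(1)])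
  qed (use f in \<open>auto intro: bounded_linear.has_vector_derivative[OF assms(1)]\<close>)
qed

lemma jet2_mult:
  fixes f g :: "real \<Rightarrow> 'a::real_normed_field"
  assumes "jet2 f p q" "jet2 g p' q'"
  shows "jet2 (\<lambda>s. f s * g s) (f 0 * p' + p * g 0) (f 0 * q' + 2 * p * p' + q * g 0)"
proof -
  obtain f' g' where
    f: "\<forall>\<^sub>F s in nhds 0. (f has_vector_derivative f' s) (at s)" "f' 0 = p" "(f' has_vector_derivative q) (at 0)" and
    g: "\<forall>\<^sub>F s in nhds 0. (g has_vector_derivative g' s) (at s)" "g' 0 = p'" "(g' has_vector_derivative q') (at 0)"
    using assms unfolding jet2_def by blast
  have f0: "(f has_vector_derivative p) (at 0)" and g0: "(g has_vector_derivative p') (at 0)"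
    using eventually_nhds_x_imp_x[OF f(1)] eventually_nhds_x_imp_x[OF g(1)] f g by auto
  show ?thesis
    unfolding jet2_def
  proof (intro exI[of _ "\<lambda>s. f s * g' s + f' s * g s"] conjI)
    show "\<forall>\<^sub>F s in nhds 0. ((\<lambda>s. f s * g s) has_vector_derivative f s * g' s + f' s * g s) (at s)"
      using f(1) g(1) by eventually_elim (rule has_vector_derivative_mult)
    show "((\<lambda>s. f s * g' s + f' s * g s) has_vector_derivative f 0 * q' + 2 * p * p' + q * g 0) (at 0)"
      using has_vector_derivative_add[OF has_vector_derivative_mult[OF f0 g(3)]
          has_vector_derivative_mult[OF f(3) g0]]
      by (simp add: f g algebra_simps)
  qed (use f g in auto)
qed

text \<open>At a local maximum \<open>f' 0 = 0\<close>, so \<open>q > 0\<close> would make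
  \<open>f'\<close> positive just to the right of 0 and \<open>f\<close> strictly increasing
  there.\<close>

lemma jet2_local_max:
  assumes "jet2 f p q" "\<forall>\<^sub>F s in nhds 0. f s \<le> f 0"
  shows "q \<le> (0::real)"
proof (rule ccontr)
  assume "\<not> q \<le> 0"
  then have q: "q > 0" by simp
  obtain f' where
    f: "\<forall>\<^sub>F s in nhds 0. (f has_real_derivative f' s) (at s)" "f' 0 = p" "(f' has_real_derivative q) (at 0)"
    using assms(1) unfolding jet2_def has_real_derivative_iff_has_vector_derivative by blast
  have "\<forall>\<^sub>F s in nhds 0. (f has_real_derivative f' s) (at s) \<and> f s \<le> f 0"
    using f(1) assms(2) by eventually_elim simp
  then obtain e where e: "e > 0" "\<And>s. \<bar>s\<bar> < e \<Longrightarrow> (f has_real_derivative f' s) (at s)"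
      "\<And>s. \<bar>s\<bar> < e \<Longrightarrow> f s \<le> f 0"
    unfolding eventually_nhds_metric dist_real_def by (metis diff_zero)
  have "(f has_real_derivative f' 0) (at 0)" using e(1) by (intro e(2)) simp
  then have p0: "f' 0 = 0"
    using e(1) by (rule DERIV_local_max) (simp add: e(3))
  obtain d where d: "d > 0" "\<And>h. 0 < h \<Longrightarrow> h < d \<Longrightarrow> f' 0 < f' (0 + h)"
    using DERIV_pos_inc_right[OF f(3) q] by blast
  define x where "x = min d e / 2"
  have x: "0 < x" "x < d" "x < e" using d(1) e(1) by (auto simp: x_def)
  have "f 0 < f x"
  proof (rule DERIV_pos_imp_increasing_open[OF x(1)])
    show "\<exists>y. (f has_real_derivative y) (at s) \<and> 0 < y" if "0 < s" "s < x" for s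
      using that x d(2)[of s] e(2)[of s] p0 by auto
    show "continuous_on {0..x} f"
    proof (rule DERIV_continuous_on[where D=f'])
      fix s assume "s \<in> {0..x}"
      then have "\<bar>s\<bar> < e" using x by simp
      then show "(f has_real_derivative f' s) (at s within {0..x})"
        by (rule e(2)[THEN has_field_derivative_at_within])
    qed
  qed
  moreover have "f x \<le> f 0" using x by (intro e(3)) simp
  ultimately show False by simp
qed

lemma Ck_on_Suc_continuous: "Ck_on (Suc k) F S \<Longrightarrow> continuous_on S F"
  by (simp add: continuous_at_imp_continuous_on differentiable_imp_continuous_within)

text \<open>Second-order chain rule. \<open>Ck_on\<close> differentiates first derivatives only in
  fixed directions, whereas the direction \<open>\<gamma>' s\<close> varies with \<open>s\<close>.
  Expanding that direction in \<open>Basis\<close> leaves scalar coefficients times derivatives in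
  fixed directions.\<close>

lemma jet2_compose:
  fixes G :: "'a::euclidean_space \<Rightarrow> 'b::real_normed_vector"
  assumes S: "open S" and G: "Ck_on 2 G S" and g0: "\<gamma> 0 \<in> S" and j: "jet2 \<gamma> a c"
  shows "jet2 (\<lambda>s. G (\<gamma> s)) (frechet_derivative G (at (\<gamma> 0)) a)
    (frechet_derivative (\<lambda>x. frechet_derivative G (at x) a) (at (\<gamma> 0)) a
      + frechet_derivative G (at (\<gamma> 0)) c)"
proof -
  obtain \<gamma>' where
    \<gamma>: "\<forall>\<^sub>F s in nhds 0. (\<gamma> has_vector_derivative \<gamma>' s) (at s)" "\<gamma>' 0 = a" "(\<gamma>' has_vector_derivative c) (at 0)"
    using j unfolding jet2_def by blast
  define D where "D = (\<lambda>x. frechet_derivative G (at x))"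
  have dG: "(G has_derivative D x) (at x)" if "x \<in> S" for x
    using G that by (auto simp: numeral_2_eq_2 D_def frechet_derivative_works[symmetric])
  have lin: "linear (D x)" if "x \<in> S" for x
    using dG[OF that] by (simp add: has_derivative_linear)
  have dD: "((\<lambda>x. D x v) has_derivative frechet_derivative (\<lambda>x. D x v) (at x)) (at x)" if "x \<in> S" for x v
    using G that by (auto simp: numeral_2_eq_2 D_def frechet_derivative_works[symmetric])
  have expand: "D x v = (\<Sum>e\<in>Basis. (v \<bullet> e) *\<^sub>R D x e)" if "x \<in> S" for x v
    by (subst euclidean_representation[of v, symmetric])
       (simp add: linear_sum[OF lin[OF that]] linear_cmul[OF lin[OF that]])
  have \<gamma>0: "(\<gamma> has_vector_derivative a) (at 0)"
    using eventually_nhds_x_imp_x[OF \<gamma>(1)] \<gamma>(2) by simp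
  have "(\<gamma> \<longlongrightarrow> \<gamma> 0) (at 0)"
    using has_vector_derivative_continuous[OF \<gamma>0] by (simp add: isCont_def)
  then have "(\<gamma> \<longlongrightarrow> \<gamma> 0) (nhds 0)"
    by (simp add: tendsto_at_iff_tendsto_nhds)
  then have evS: "\<forall>\<^sub>F s in nhds 0. \<gamma> s \<in> S"
    using S g0 by (rule topological_tendstoD)
  \<comment> \<open>Reassembles the terms over \<open>Basis\<close> into one second derivative in
    the fixed direction \<open>a\<close>.\<close>
  have D_a: "frechet_derivative (\<lambda>x. D x a) (at (\<gamma> 0))
      = (\<lambda>h. \<Sum>e\<in>Basis. (a \<bullet> e) *\<^sub>R frechet_derivative (\<lambda>x. D x e) (at (\<gamma> 0)) h)"
  proof (rule frechet_derivative_at[symmetric])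
    show "((\<lambda>x. D x a) has_derivative
        (\<lambda>h. \<Sum>e\<in>Basis. (a \<bullet> e) *\<^sub>R frechet_derivative (\<lambda>x. D x e) (at (\<gamma> 0)) h)) (at (\<gamma> 0))"
    proof (rule has_derivative_transform_within_open[OF _ S g0])
      show "((\<lambda>x. \<Sum>e\<in>Basis. (a \<bullet> e) *\<^sub>R D x e) has_derivative
          (\<lambda>h. \<Sum>e\<in>Basis. (a \<bullet> e) *\<^sub>R frechet_derivative (\<lambda>x. D x e) (at (\<gamma> 0)) h)) (at (\<gamma> 0))"
        by (rule has_derivative_sum, rule has_derivative_scaleR_right, rule dD[OF g0])
      show "(\<Sum>e\<in>Basis. (a \<bullet> e) *\<^sub>R D x e) = D x a" if "x \<in> S" for x
        by (rule expand[OF that, symmetric])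
    qed
  qed
  show ?thesis
    unfolding jet2_def
  proof (intro exI[of _ "\<lambda>s. D (\<gamma> s) (\<gamma>' s)"] conjI)
    show "\<forall>\<^sub>F s in nhds 0. ((\<lambda>s. G (\<gamma> s)) has_vector_derivative D (\<gamma> s) (\<gamma>' s)) (at s)"
      using \<gamma>(1) evS
    proof eventually_elim
      case (elim s)
      show ?case
        using vector_derivative_diff_chain_within[of \<gamma> "\<gamma>' s" s UNIV G "D (\<gamma> s)"] elim
          has_derivative_at_withinI[OF dG] by (simp add: o_def)
    qed
    show "D (\<gamma> 0) (\<gamma>' 0) = frechet_derivative G (at (\<gamma> 0)) a" by (simp add: D_def \<gamma>)
    have 1: "((\<lambda>s. D (\<gamma> s) e) has_vector_derivative frechet_derivative (\<lambda>x. D x e) (at (\<gamma> 0)) a) (at 0)" for e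
      using vector_derivative_diff_chain_within[of \<gamma> a 0 UNIV "\<lambda>x. D x e"] \<gamma>0
        has_derivative_at_withinI[OF dD[OF g0]] by (simp add: o_def)
    have 2: "((\<lambda>s. \<gamma>' s \<bullet> e) has_real_derivative c \<bullet> e) (at 0)" for e
      unfolding has_real_derivative_iff_has_vector_derivative
      by (rule bounded_linear.has_vector_derivative[OF bounded_linear_inner_left \<gamma>(3)])
    have "((\<lambda>s. \<Sum>e\<in>Basis. (\<gamma>' s \<bullet> e) *\<^sub>R D (\<gamma> s) e) has_vector_derivative
       (\<Sum>e\<in>Basis. (\<gamma>' 0 \<bullet> e) *\<^sub>R frechet_derivative (\<lambda>x. D x e) (at (\<gamma> 0)) a + (c \<bullet> e) *\<^sub>R D (\<gamma> 0) e)) (at 0)"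
      by (rule has_vector_derivative_sum, rule has_vector_derivative_scaleR[OF 2 1])
    also have "(\<Sum>e\<in>Basis. (\<gamma>' 0 \<bullet> e) *\<^sub>R frechet_derivative (\<lambda>x. D x e) (at (\<gamma> 0)) a + (c \<bullet> e) *\<^sub>R D (\<gamma> 0) e)
       = frechet_derivative (\<lambda>x. D x a) (at (\<gamma> 0)) a + D (\<gamma> 0) c"
      by (subst expand[OF g0, of c]) (simp add: sum.distrib D_a \<gamma>(2))
    finally have "((\<lambda>s. D (\<gamma> s) (\<gamma>' s)) has_vector_derivative
       frechet_derivative (\<lambda>x. D x a) (at (\<gamma> 0)) a + D (\<gamma> 0) c) (at 0)"
    proof (rule has_vector_derivative_cong_ev[THEN iffD2, rotated 2])
      show "\<forall>\<^sub>F x in nhds 0. x \<in> UNIV \<longrightarrow> D (\<gamma> x) (\<gamma>' x) = (\<Sum>e\<in>Basis. (\<gamma>' x \<bullet> e) *\<^sub>R D (\<gamma> x) e)"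
        using evS
      proof eventually_elim
        case (elim s)
        show ?case by (intro impI expand elim)
      qed
      show "D (\<gamma> 0) (\<gamma>' 0) = (\<Sum>e\<in>Basis. (\<gamma>' 0 \<bullet> e) *\<^sub>R D (\<gamma> 0) e)"
        by (rule expand[OF g0])
    qed
    then show "((\<lambda>s. D (\<gamma> s) (\<gamma>' s)) has_vector_derivative
       frechet_derivative (\<lambda>x. frechet_derivative G (at x) a) (at (\<gamma> 0)) a + frechet_derivative G (at (\<gamma> 0)) c) (at 0)"
      by (simp only: D_def)
  qed
qed

text \<open>The factor \<open>\<theta>^2\<close> is 1 for \<open>\<theta> = 1\<close> and -1 for
  \<open>\<theta> = \<i>\<close>: holomorphic second derivatives cancel when the two directions are
  added.\<close>

lemma jet2_holomorphic:
  assumes "f holomorphic_on S" "open S" "0 \<in> S"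
  shows "jet2 (\<lambda>s. f (of_real s * \<theta>)) (\<theta> * deriv f 0) (\<theta>^2 * deriv (deriv f) 0)"
proof -
  have "((\<lambda>s::real. of_real s * \<theta>) \<longlongrightarrow> of_real 0 * \<theta>) (nhds 0)"
    by (rule tendsto_mult[OF tendsto_of_real[OF filterlim_ident] tendsto_const])
  then have ev: "\<forall>\<^sub>F s::real in nhds 0. of_real s * \<theta> \<in> S"
    by (rule topological_tendstoD) (use assms in simp_all)
  have 1: "((\<lambda>s::real. of_real s * \<theta>) has_vector_derivative \<theta>) (at s)" for s
    unfolding has_vector_derivative_def scaleR_conv_of_real
    by (rule bounded_linear_imp_has_derivative, rule bounded_linear_compose[OF bounded_linear_mult_left bounded_linear_of_real])
  have 2: "((\<lambda>s. g (of_real s * \<theta>)) has_vector_derivative \<theta> * deriv g (of_real s * \<theta>)) (at s)"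
    if "g holomorphic_on S" "of_real s * \<theta> \<in> S" for g s
    using field_vector_diff_chain_at[OF 1[of s] holomorphic_derivI[OF that(1) assms(2) that(2)]]
    by (simp add: o_def)
  show ?thesis
    unfolding jet2_def
  proof (intro exI[of _ "\<lambda>s. \<theta> * deriv f (of_real s * \<theta>)"] conjI)
    show "\<forall>\<^sub>F s in nhds 0. ((\<lambda>s. f (of_real s * \<theta>)) has_vector_derivative \<theta> * deriv f (of_real s * \<theta>)) (at s)"
      using ev by eventually_elim (rule 2[OF assms(1)])
    have "((\<lambda>s. deriv f (of_real s * \<theta>)) has_vector_derivative \<theta> * deriv (deriv f) (of_real 0 * \<theta>)) (at 0)"
      by (rule 2) (use holomorphic_deriv[OF assms(1,2)] assms in auto)
    from bounded_linear.has_vector_derivative[OF bounded_linear_mult_right this, of \<theta>]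
    show "((\<lambda>s. \<theta> * deriv f (of_real s * \<theta>)) has_vector_derivative \<theta>^2 * deriv (deriv f) 0) (at 0)"
      by (simp add: power2_eq_square mult.assoc)
  qed auto
qed


section \<open>Derivatives of holomorphic maps of several variables\<close>

lemma norm_vec_smult: "norm (a *s v) = norm a * norm v" for v :: "complex^'n"
  by (simp add: norm_vec_def L2_set_right_distrib norm_mult)

lemma mv_holomorphic_on_has_derivative:
  assumes "mv_holomorphic_on F S" "z \<in> S"
  shows "(F has_derivative frechet_derivative F (at z)) (at z)"
  using assms unfolding mv_holomorphic_on_def
  by (metis differentiableI frechet_derivative_works)

lemma mv_holomorphic_on_linear:
  assumes "mv_holomorphic_on F S" "z \<in> S"
  shows "Vector_Spaces.linear (*s) (*s) (frechet_derivative F (at z))"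
  using assms unfolding mv_holomorphic_on_def
  by (metis frechet_derivative_at)

lemma mv_holomorphic_on_derivative_add:
  assumes "mv_holomorphic_on F S" "z \<in> S"
  shows "frechet_derivative F (at z) (x + y) = frechet_derivative F (at z) x + frechet_derivative F (at z) y"
  using mv_holomorphic_on_linear[OF assms] by (simp add: Vector_Spaces.linear_iff)

lemma mv_holomorphic_on_derivative_smult:
  assumes "mv_holomorphic_on F S" "z \<in> S"
  shows "frechet_derivative F (at z) (a *s x) = a *s frechet_derivative F (at z) x"
  using mv_holomorphic_on_linear[OF assms] by (simp add: Vector_Spaces.linear_iff)

lemma mv_holomorphic_on_imp_continuous_on:
  assumes "mv_holomorphic_on F S"
  shows "continuous_on S F"
proof (rule continuous_at_imp_continuous_on, rule ballI)
  fix z assume "z \<in> S"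
  then show "isCont F z"
    using mv_holomorphic_on_has_derivative[OF assms] has_derivative_continuous by blast
qed

section \<open>Restriction of holomorphic maps to complex lines\<close>

lemma has_derivative_complex_line: "((\<lambda>t. z + t *s u) has_derivative (\<lambda>h. h *s u)) (at t)"
  for z u :: "complex^'n"
proof -
  have "bounded_linear (\<lambda>h. h *s u)"
    by (rule bounded_linear_intro[where K="norm u"])
       (auto simp: norm_vec_smult vec_eq_iff algebra_simps)
  from has_derivative_add[OF has_derivative_const[of z] bounded_linear_imp_has_derivative[OF this]]
  show ?thesis by simp
qed

lemma mv_holomorphic_on_line_derivative:
  assumes "mv_holomorphic_on F S" "z + t *s u \<in> S"
  shows "((\<lambda>t. F (z + t *s u) $ k) has_field_derivative frechet_derivative F (at (z + t *s u)) u $ k) (at t)"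
proof -
  have "((\<lambda>t. F (z + t *s u)) has_derivative (\<lambda>h. frechet_derivative F (at (z + t *s u)) (h *s u))) (at t)"
    using has_derivative_compose[OF has_derivative_complex_line mv_holomorphic_on_has_derivative[OF assms]] .
  from bounded_linear.has_derivative[OF bounded_linear_vec_nth this, of k]
  show ?thesis
    unfolding has_field_derivative_def mv_holomorphic_on_derivative_smult[OF assms] vector_smult_component
    by (rule has_derivative_eq_rhs) (rule ext, rule mult.commute)
qed

lemma open_complex_line: "open S \<Longrightarrow> open {t. z + t *s u \<in> S}" for z u :: "complex^'n"
proof -
  assume S: "open S"
  have "continuous_on UNIV (\<lambda>t. z + t *s u)"
    by (rule continuous_at_imp_continuous_on)
       (blast intro: has_derivative_continuous has_derivative_complex_line)
  from open_vimage[OF S this] show ?thesis by (simp add: vimage_def)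
qed

lemma mv_holomorphic_on_line_holomorphic:
  assumes "mv_holomorphic_on F S" "open S"
  shows "(\<lambda>t. F (z + t *s u) $ k) holomorphic_on {t. z + t *s u \<in> S}"
  using mv_holomorphic_on_line_derivative[OF assms(1)]
  unfolding holomorphic_on_open[OF open_complex_line[OF assms(2)]] by blast

section \<open>Cauchy estimates and the regularity of the derivative\<close>

text \<open>Taylor's formula of order one, with the second derivative bounded by Cauchy's inequality
  on discs of radius \<open>d/2\<close> inside \<open>cball 0 d\<close>; the constant is
  \<open>2 * B / (d/2)^2\<close>. It depends on \<open>f\<close> only through \<open>B\<close> and
  \<open>d\<close>, hence is uniform over a family of lines.\<close>

lemma holomorphic_difference_quotient_bound:
  assumes f: "f holomorphic_on S" and S: "open S" "cball 0 d \<subseteq> S" and d: "d > 0"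
    and B: "\<And>x. x \<in> cball 0 d \<Longrightarrow> norm (f x) \<le> B" and h: "norm h \<le> d / 2"
  shows "norm (f h - f 0 - deriv f 0 * h) \<le> 8 * B / d^2 * (norm h)^2"
proof -
  let ?K = "cball (0::complex) (d/2)"
  have sub: "cball x (d/2) \<subseteq> cball 0 d" if "x \<in> ?K" for x
  proof
    fix t assume "t \<in> cball x (d/2)"
    then show "t \<in> cball 0 d"
      using that dist_triangle[of 0 t x] by simp
  qed
  have K: "?K \<subseteq> S" using S(2) d by (force simp: dist_norm)
  have holo: "(deriv ^^ i) f holomorphic_on S" for i
    by (rule holomorphic_higher_deriv[OF f S(1)])
  have "cmod ((deriv ^^ 0) f h - (\<Sum>i\<le>1. (deriv ^^ i) f 0 * (h - 0) ^ i / fact i))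
      \<le> 8 * B / d^2 * cmod (h - 0) ^ Suc 1 / fact 1"
  proof (rule complex_Taylor[where S="?K"])
    fix i x assume x: "x \<in> ?K"
    have "((deriv ^^ i) f has_field_derivative deriv ((deriv ^^ i) f) x) (at x)"
      using holomorphic_derivI[OF holo S(1)] x K by blast
    then show "((deriv ^^ i) f has_field_derivative (deriv ^^ (Suc i)) f x) (at x within ?K)"
      by (simp add: has_field_derivative_at_within)
  next
    fix x assume x: "x \<in> ?K"
    have "norm ((deriv ^^ 2) f x) \<le> fact 2 * B / (d/2)^2"
    proof (rule Cauchy_inequality)
      show "f holomorphic_on ball x (d/2)"
        using f sub[OF x] S(2) ball_subset_cball by (blast intro: holomorphic_on_subset)
      show "continuous_on (cball x (d/2)) f"
        using f sub[OF x] S(2) by (blast intro: holomorphic_on_subset holomorphic_on_imp_continuous_on)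
      show "norm (f y) \<le> B" if "norm (x - y) = d/2" for y
        using sub[OF x] that by (intro B) (auto simp: dist_norm)
    qed (use d in simp)
    also have "\<dots> = 8 * B / d^2" by (simp add: power2_eq_square)
    finally show "cmod ((deriv ^^ (Suc 1)) f x) \<le> 8 * B / d^2" by (simp add: numeral_2_eq_2)
  qed (use h d in auto)
  then show ?thesis by (simp add: power2_eq_square diff_diff_eq)
qed

text \<open>One bound \<open>B\<close> of \<open>F\<close> on a compact ball serves all lines in
  direction \<open>v\<close> that start near \<open>z0\<close>, so the Taylor error is uniform in
  the base point. Continuity, and holomorphy along lines, can then pass from \<open>F\<close> to its
  derivative.\<close>

lemma mv_holomorphic_on_uniform_limit:
  assumes F: "mv_holomorphic_on F S" and S: "open S" "z0 \<in> S"
  obtains r N where "r > 0" "cball z0 r \<subseteq> S"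
    "\<And>n z. n \<ge> N \<Longrightarrow> z \<in> cball z0 r \<Longrightarrow> z + (1 / of_nat (Suc n)) *s v \<in> S"
    "uniform_limit (cball z0 r) (\<lambda>n z. of_nat (Suc n) * (F (z + (1 / of_nat (Suc n)) *s v) $ k - F z $ k))
      (\<lambda>z. frechet_derivative F (at z) v $ k) sequentially"
proof -
  obtain e where e: "e > 0" "cball z0 e \<subseteq> S" using S open_contains_cball by blast
  define r where "r = e / 2"
  \<comment> \<open>Steps of size at most \<open>d\<close> in direction \<open>v\<close> move a
    point by at most \<open>r\<close>, so points of \<open>cball z0 r\<close> stay in
    \<open>cball z0 e\<close>; the summand 1 covers \<open>v = 0\<close>.\<close>
  define d where "d = r / (1 + norm v)"
  have n1: "1 + norm v > 0" by (smt (verit) norm_ge_zero)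
  have r: "r > 0" and d: "d > 0" using e n1 by (auto simp: r_def d_def)
  have "compact ((\<lambda>z. F z $ k) ` cball z0 e)"
    by (intro compact_continuous_image continuous_on_component compact_cball
          continuous_on_subset[OF mv_holomorphic_on_imp_continuous_on[OF F] e(2)])
  then obtain B where B: "\<And>z. z \<in> cball z0 e \<Longrightarrow> norm (F z $ k) \<le> B"
    using compact_imp_bounded bounded_iff by (metis (no_types, lifting) imageI)
  have mem: "z + \<epsilon> *s v \<in> cball z0 e" if "z \<in> cball z0 r" "norm \<epsilon> \<le> d" for z \<epsilon>
  proof -
    have "norm (\<epsilon> *s v) \<le> d * (1 + norm v)"
      unfolding norm_vec_smult by (intro mult_mono that) (use d in auto)
    also have "\<dots> = r" using n1 by (simp add: d_def)
    finally have "dist z0 (z + \<epsilon> *s v) \<le> r + r"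
      using that(1) norm_triangle_ineq4[of "z0 - z" "\<epsilon> *s v"] by (simp add: dist_norm algebra_simps)
    then show ?thesis by (simp add: r_def)
  qed
  have key: "norm (of_nat (Suc n) * (F (z + (1 / of_nat (Suc n)) *s v) $ k - F z $ k)
      - frechet_derivative F (at z) v $ k) \<le> 8 * B / d^2 / real (Suc n)"
    if z: "z \<in> cball z0 r" and n: "1 / real (Suc n) \<le> d / 2" for n z
  proof -
    define f where "f = (\<lambda>t. F (z + t *s v) $ k)"
    define h where "h = (1 / of_nat (Suc n) :: complex)"
    have nh: "norm h = 1 / real (Suc n)" by (simp add: h_def norm_divide del: of_nat_Suc)
    have zS: "z + 0 *s v \<in> S" using mem[OF z, of 0] d e(2) by auto
    have "norm (f h - f 0 - deriv f 0 * h) \<le> 8 * B / d^2 * (norm h)^2"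
    proof (rule holomorphic_difference_quotient_bound)
      show "f holomorphic_on {t. z + t *s v \<in> S}"
        unfolding f_def by (rule mv_holomorphic_on_line_holomorphic[OF F S(1)])
      show "open {t. z + t *s v \<in> S}" by (rule open_complex_line[OF S(1)])
      show "cball 0 d \<subseteq> {t. z + t *s v \<in> S}" using mem[OF z] e(2) by auto
      show "norm (f x) \<le> B" if "x \<in> cball 0 d" for x
        unfolding f_def using that by (intro B mem z) simp
      show "norm h \<le> d / 2" using n nh by simp
    qed (rule d)
    moreover have "deriv f 0 = frechet_derivative F (at z) v $ k"
      using DERIV_imp_deriv[OF mv_holomorphic_on_line_derivative[OF F zS]] by (simp add: f_def)
    ultimately have "norm (of_nat (Suc n) * (f h - f 0 - frechet_derivative F (at z) v $ k * h))
        \<le> real (Suc n) * (8 * B / d^2 * (norm h)^2)"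
      unfolding norm_mult norm_of_nat by (intro mult_left_mono) auto
    \<comment> \<open>The error is quadratic in \<open>h\<close>, so dividing by \<open>h\<close>
      still leaves a factor tending to 0.\<close>
    also have "\<dots> = 8 * B / d^2 / real (Suc n)"
      unfolding nh by (simp add: power2_eq_square del: of_nat_Suc)
    also have "of_nat (Suc n) * (f h - f 0 - frechet_derivative F (at z) v $ k * h)
       = of_nat (Suc n) * (f h - f 0) - frechet_derivative F (at z) v $ k"
      unfolding h_def by (simp add: right_diff_distrib del: of_nat_Suc)
    finally show ?thesis by (simp add: f_def h_def)
  qed
  obtain N where N: "1 / real (Suc N) < d / 2" using nat_approx_posE[of "d/2"] d by auto
  have N': "1 / real (Suc n) \<le> d / 2" if "n \<ge> N" for n
  proof -
    have "1 / real (Suc n) \<le> 1 / real (Suc N)" using that by (intro divide_left_mono) auto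
    then show ?thesis using N by simp
  qed
  show ?thesis
  proof (rule that[OF r])
    show "cball z0 r \<subseteq> S" using e by (force simp: r_def)
    show "z + (1 / of_nat (Suc n)) *s v \<in> S" if "n \<ge> N" "z \<in> cball z0 r" for n z
    proof -
      have "norm (1 / of_nat (Suc n) :: complex) \<le> d"
        using N'[OF that(1)] d by (simp add: norm_divide del: of_nat_Suc)
      then show ?thesis using mem[OF that(2)] e(2) by blast
    qed
    show "uniform_limit (cball z0 r) (\<lambda>n z. of_nat (Suc n) * (F (z + (1 / of_nat (Suc n)) *s v) $ k - F z $ k))
      (\<lambda>z. frechet_derivative F (at z) v $ k) sequentially"
    proof (rule uniform_limitI)
      fix \<epsilon> :: real assume \<epsilon>: "\<epsilon> > 0"
      have "(\<lambda>n. 8 * B / d^2 / real (Suc n)) \<longlonglongrightarrow> 0"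
        using LIMSEQ_Suc[OF lim_const_over_n[of "8 * B / d^2"]] by simp
      then have "\<forall>\<^sub>F n in sequentially. 8 * B / d^2 / real (Suc n) < \<epsilon>"
        using \<epsilon> by (rule order_tendstoD)
      then show "\<forall>\<^sub>F n in sequentially. \<forall>z\<in>cball z0 r. dist (of_nat (Suc n) * (F (z + (1 / of_nat (Suc n)) *s v) $ k - F z $ k))
          (frechet_derivative F (at z) v $ k) < \<epsilon>"
        using eventually_ge_at_top[of N]
      proof eventually_elim
        case (elim n)
        show ?case
        proof
          fix z assume "z \<in> cball z0 r"
          from key[OF this N'[OF elim(2)]] elim(1)
          show "dist (of_nat (Suc n) * (F (z + (1 / of_nat (Suc n)) *s v) $ k - F z $ k))
          (frechet_derivative F (at z) v $ k) < \<epsilon>"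
            unfolding dist_norm by (rule le_less_trans)
        qed
      qed
    qed
  qed
qed

lemma continuous_on_vec_componentwise:
  "continuous_on S f \<longleftrightarrow> (\<forall>k. continuous_on S (\<lambda>x. f x $ k))" for f :: "_ \<Rightarrow> ('b::topological_space)^'n"
  using continuous_on_vec_lambda[of S "\<lambda>k x. f x $ k"] continuous_on_component[of S f] by auto

text \<open>Near each point the derivative is a uniform limit of difference quotients, which are
  continuous because \<open>F\<close> is.\<close>

lemma mv_holomorphic_on_derivative_continuous:
  assumes F: "mv_holomorphic_on F S" and S: "open S"
  shows "continuous_on S (\<lambda>z. frechet_derivative F (at z) v)"
  unfolding continuous_on_vec_componentwise
proof
  fix k
  show "continuous_on S (\<lambda>z. frechet_derivative F (at z) v $ k)"
  proof (rule continuous_at_imp_continuous_on, rule ballI)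
    fix z0 assume z0: "z0 \<in> S"
    obtain r N where r: "r > 0" "cball z0 r \<subseteq> S"
      "\<And>n z. n \<ge> N \<Longrightarrow> z \<in> cball z0 r \<Longrightarrow> z + (1 / of_nat (Suc n)) *s v \<in> S"
      "uniform_limit (cball z0 r) (\<lambda>n z. of_nat (Suc n) * (F (z + (1 / of_nat (Suc n)) *s v) $ k - F z $ k))
        (\<lambda>z. frechet_derivative F (at z) v $ k) sequentially"
      using mv_holomorphic_on_uniform_limit[OF F S z0] by blast
    have cF: "continuous_on S (\<lambda>z. F z $ k)"
      by (intro continuous_on_component mv_holomorphic_on_imp_continuous_on F)
    have "continuous_on (cball z0 r) (\<lambda>z. frechet_derivative F (at z) v $ k)"
    proof (rule uniform_limit_theorem[OF _ r(4)])
      show "\<forall>\<^sub>F n in sequentially. continuous_on (cball z0 r)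
          (\<lambda>z. of_nat (Suc n) * (F (z + (1 / of_nat (Suc n)) *s v) $ k - F z $ k))"
        using eventually_ge_at_top[of N]
      proof eventually_elim
        case (elim n)
        have "continuous_on (cball z0 r) (\<lambda>z. F (z + (1 / of_nat (Suc n)) *s v) $ k)"
          by (rule continuous_on_compose2[OF cF])
             (use r(3)[OF elim] in \<open>auto intro!: continuous_intros simp del: of_nat_Suc\<close>)
        then show ?case
          by (rule continuous_on_mult[OF continuous_on_const continuous_on_diff[OF _ continuous_on_subset[OF cF r(2)]]])
      qed
    qed simp
    then show "isCont (\<lambda>z. frechet_derivative F (at z) v $ k) z0"
      by (rule continuous_on_interior) (use r(1) in simp)
  qed
qed

text \<open>Weierstrass: a locally uniform limit of holomorphic functions is holomorphic. The line
  runs in direction \<open>u\<close> and the derivative is taken in direction \<open>v\<close>, as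
  required to push a vector field forward along a line.\<close>

lemma mv_holomorphic_on_derivative_line_holomorphic:
  assumes F: "mv_holomorphic_on F S" and S: "open S" and z: "z \<in> S"
  obtains T where "open T" "0 \<in> T" "\<And>t. t \<in> T \<Longrightarrow> z + t *s u \<in> S"
    "(\<lambda>t. frechet_derivative F (at (z + t *s u)) v $ k) holomorphic_on T"
proof -
  obtain r N where r: "r > 0" "cball z r \<subseteq> S"
    "\<And>n x. n \<ge> N \<Longrightarrow> x \<in> cball z r \<Longrightarrow> x + (1 / of_nat (Suc n)) *s v \<in> S"
    "uniform_limit (cball z r) (\<lambda>n z. of_nat (Suc n) * (F (z + (1 / of_nat (Suc n)) *s v) $ k - F z $ k))
      (\<lambda>z. frechet_derivative F (at z) v $ k) sequentially"
    using mv_holomorphic_on_uniform_limit[OF F S z] by blast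
  define T where "T = {t. z + t *s u \<in> ball z r}"
  have T: "open T" "0 \<in> T" using open_complex_line[of "ball z r"] r(1) by (auto simp: T_def)
  have TS: "z + t *s u \<in> cball z r" if "t \<in> T" for t
    using that by (simp add: T_def)
  \<comment> \<open>With the shift by \<open>v\<close> taken before the motion along
    \<open>u\<close>, each quotient is a difference of restrictions of \<open>F\<close> to two
    parallel complex lines, so it is holomorphic in \<open>t\<close>.\<close>
  define g where "g = (\<lambda>n t. of_nat (Suc n) * (F ((z + (1 / of_nat (Suc n)) *s v) + t *s u) $ k - F (z + t *s u) $ k))"
  have "uniform_limit T (\<lambda>n t. of_nat (Suc n) * (F (z + t *s u + (1 / of_nat (Suc n)) *s v) $ k - F (z + t *s u) $ k))
      (\<lambda>t. frechet_derivative F (at (z + t *s u)) v $ k) sequentially"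
    by (rule uniform_limit_compose'[OF r(4)]) (use TS in blast)
  moreover have "(\<lambda>n t. of_nat (Suc n) * (F (z + t *s u + (1 / of_nat (Suc n)) *s v) $ k - F (z + t *s u) $ k)) = g"
    by (simp add: g_def algebra_simps)
  ultimately have lim: "uniform_limit T g (\<lambda>t. frechet_derivative F (at (z + t *s u)) v $ k) sequentially"
    by simp
  have "(\<lambda>t. frechet_derivative F (at (z + t *s u)) v $ k) holomorphic_on T"
  proof (rule holomorphic_uniform_sequence[OF T(1)])
    \<comment> \<open>For indices below \<open>N\<close> the shifted point may lie outside
      \<open>S\<close>, where nothing is known about \<open>F\<close>.\<close>
    show "g (n + N) holomorphic_on T" for n
    proof -
      have shift: "z + (1 / of_nat (Suc (n + N))) *s v + t *s u \<in> S" if "t \<in> T" for t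
        using r(3)[OF le_add2 TS[OF that], of n] by (simp add: ac_simps del: of_nat_Suc)
      have "(\<lambda>t. F (z + (1 / of_nat (Suc (n + N))) *s v + t *s u) $ k) holomorphic_on T"
        by (rule holomorphic_on_subset[OF mv_holomorphic_on_line_holomorphic[OF F S]])
           (use shift in blast)
      moreover have "(\<lambda>t. F (z + t *s u) $ k) holomorphic_on T"
        by (rule holomorphic_on_subset[OF mv_holomorphic_on_line_holomorphic[OF F S]]) (use TS r(2) in auto)
      ultimately show ?thesis unfolding g_def by (intro holomorphic_intros)
    qed
    show "\<exists>d>0. cball x d \<subseteq> T \<and> uniform_limit (cball x d) (\<lambda>n. g (n + N))
        (\<lambda>t. frechet_derivative F (at (z + t *s u)) v $ k) sequentially" if "x \<in> T" for x
    proof -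
      obtain d where d: "d > 0" "cball x d \<subseteq> T" using T(1) \<open>x \<in> T\<close> open_contains_cball by blast
      have "uniform_limit (cball x d) g (\<lambda>t. frechet_derivative F (at (z + t *s u)) v $ k) sequentially"
        by (rule uniform_limit_on_subset[OF lim d(2)])
      then have "uniform_limit (cball x d) (\<lambda>n. g (n + N)) (\<lambda>t. frechet_derivative F (at (z + t *s u)) v $ k) sequentially"
        unfolding uniform_limit_iff
      proof (intro allI impI)
        fix e :: real
        assume *: "\<forall>e>0. \<forall>\<^sub>F n in sequentially. \<forall>y\<in>cball x d.
            dist (g n y) (frechet_derivative F (at (z + y *s u)) v $ k) < e" and "e > 0"
        then have "\<forall>\<^sub>F n in sequentially. \<forall>y\<in>cball x d.
            dist (g n y) (frechet_derivative F (at (z + y *s u)) v $ k) < e" by blast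
        from sequentially_offset[OF this, of N]
        show "\<forall>\<^sub>F n in sequentially. \<forall>y\<in>cball x d.
            dist (g (n + N) y) (frechet_derivative F (at (z + y *s u)) v $ k) < e" .
      qed
      then show ?thesis using d by blast
    qed
  qed
  then show ?thesis using T TS r(2) that by blast
qed

text \<open>Re-centring the line at \<open>z + t0 *s u\<close> carries the local statement at
  parameter 0 to every parameter \<open>t0\<close>.\<close>

lemma mv_holomorphic_on_derivative_line_holomorphic_on:
  assumes F: "mv_holomorphic_on F S" and S: "open S"
  shows "(\<lambda>t. frechet_derivative F (at (z + t *s u)) v $ k) holomorphic_on {t. z + t *s u \<in> S}"
  unfolding holomorphic_on_open[OF open_complex_line[OF S]]
proof
  fix t0 assume "t0 \<in> {t. z + t *s u \<in> S}"
  then obtain T where T: "open T" "0 \<in> T"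
    and hol: "(\<lambda>t. frechet_derivative F (at (z + t0 *s u + t *s u)) v $ k) holomorphic_on T"
    using mv_holomorphic_on_derivative_line_holomorphic[OF F S, of "z + t0 *s u" u v k] by blast
  define g where "g = (\<lambda>t. frechet_derivative F (at (z + t0 *s u + t *s u)) v $ k)"
  have "(g has_field_derivative deriv g 0) (at (t0 - t0))"
    using holomorphic_derivI[OF hol T] by (simp add: g_def)
  moreover have "((\<lambda>t. t - t0) has_field_derivative 1) (at t0)"
    by (auto intro!: derivative_eq_intros)
  ultimately have "((\<lambda>t. g (t - t0)) has_field_derivative deriv g 0 * 1) (at t0)"
    by (rule DERIV_chain2[where g="\<lambda>t. t - t0"])
  moreover have "g (t - t0) = frechet_derivative F (at (z + t *s u)) v $ k" for t
  proof -
    have "z + t0 *s u + (t - t0) *s u = z + t *s u"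
      by (simp add: vec_eq_iff algebra_simps)
    then show ?thesis by (simp only: g_def)
  qed
  ultimately show "\<exists>f'. ((\<lambda>t. frechet_derivative F (at (z + t *s u)) v $ k) has_field_derivative f') (at t0)"
    by auto
qed


section \<open>Hermitian forms and Wirtinger derivatives\<close>

definition hform :: "complex^'n^'n \<Rightarrow> complex^'n \<Rightarrow> complex^'n \<Rightarrow> complex" where
  "hform A x y = (\<Sum>k\<in>UNIV. \<Sum>l\<in>UNIV. A $ k $ l * x $ k * cnj (y $ l))"

lemma hform_diff_left: "hform A (x - y) w = hform A x w - hform A y w"
  by (simp add: hform_def algebra_simps sum_subtractf)

lemma hform_diff_right: "hform A w (x - y) = hform A w x - hform A w y"
  by (simp add: hform_def algebra_simps sum_subtractf)

lemma hform_smult: "hform A (a *s x) (b *s y) = a * cnj b * hform A x y"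
  by (simp add: hform_def algebra_simps sum_distrib_left)

lemma hform_zero [simp]: "hform A 0 y = 0" "hform A x 0 = 0"
  by (simp_all add: hform_def)

lemma hform_cnj:
  assumes "\<And>k l. A $ l $ k = cnj (A $ k $ l)"
  shows "hform A y x = cnj (hform A x y)"
proof -
  have "cnj (hform A x y) = (\<Sum>k\<in>UNIV. \<Sum>l\<in>UNIV. A $ l $ k * y $ l * cnj (x $ k))"
    by (simp add: hform_def assms[symmetric] mult.commute mult.left_commute)
  also have "\<dots> = hform A y x" unfolding hform_def by (rule sum.swap)
  finally show ?thesis by simp
qed

lemma pos_def_imp_invertible:
  fixes A :: "complex^'n^'n"
  assumes "\<And>x. x \<noteq> 0 \<Longrightarrow> Re (hform A x x) > 0"
  shows "invertible A"
  unfolding invertible_left_inverse matrix_left_invertible_ker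
proof (intro allI impI)
  fix x assume x: "A *v x = 0"
  \<comment> \<open>\<open>hform\<close> pairs the column index of \<open>A\<close> with a
    conjugated vector, so a kernel vector has to be conjugated before positivity applies to
    it.\<close>
  define y where "y = (\<chi> i. cnj (x $ i))"
  have "hform A y y = (\<Sum>k\<in>UNIV. y $ k * (A *v x) $ k)"
    by (simp add: hform_def y_def matrix_vector_mult_def sum_distrib_left ac_simps)
  then have "hform A y y = 0" by (simp add: x)
  then have "y = 0" using assms[of y] by (cases "y = 0") simp_all
  then show "x = 0" by (simp add: y_def vec_eq_iff)
qed

lemma matrix_inv_mult_left: "invertible A \<Longrightarrow> matrix_inv A ** A = mat 1"
  unfolding invertible_def matrix_inv_def by (rule someI2_ex) auto

section \<open>Metrics and curvature in a coordinate domain\<close>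

text \<open>The curvature evaluated on plain coordinate vectors, so that the analysis can take place
  on open sets of complex Euclidean space.\<close>

definition chern_form :: "(complex^'n \<Rightarrow> complex^'n^'n) \<Rightarrow> complex^'n \<Rightarrow> complex^'n \<Rightarrow> complex^'n \<Rightarrow> complex" where
  "chern_form G z u v = (\<Sum>i\<in>UNIV. \<Sum>j\<in>UNIV. \<Sum>k\<in>UNIV. \<Sum>l\<in>UNIV.
     chern_component G z i j k l * u $ i * cnj (u $ j) * v $ k * cnj (v $ l))"

definition local_metric :: "(complex^'n \<Rightarrow> complex^'n^'n) \<Rightarrow> (complex^'n) set \<Rightarrow> bool" where
  "local_metric G S \<longleftrightarrow> open S \<and> (\<forall>k l. Ck_on 2 (\<lambda>z. G z $ k $ l) S) \<and>
     (\<forall>z\<in>S. (\<forall>k l. G z $ l $ k = cnj (G z $ k $ l)) \<and> (\<forall>x. x \<noteq> 0 \<longrightarrow> Re (hform (G z) x x) > 0))"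

lemma frechet_derivative_cong_open:
  assumes "open S" "z \<in> S" "\<And>x. x \<in> S \<Longrightarrow> f x = g x"
  shows "frechet_derivative f (at z) = frechet_derivative g (at z)"
proof -
  have "(f has_derivative D) (at z) \<longleftrightarrow> (g has_derivative D) (at z)" for D
    using has_derivative_transform_within_open[OF _ assms(1,2), of f D UNIV g]
      has_derivative_transform_within_open[OF _ assms(1,2), of g D UNIV f] assms(3) by metis
  then show ?thesis by (simp add: frechet_derivative_def)
qed

lemma frechet_derivative_cnj:
  assumes "f differentiable (at z)"
  shows "frechet_derivative (\<lambda>x. cnj (f x)) (at z) v = cnj (frechet_derivative f (at z) v)"
  using frechet_derivative_at[OF bounded_linear.has_derivative[OF bounded_linear_cnj
      assms[unfolded frechet_derivative_works]]] by metis

section \<open>Wirtinger derivatives along complex lines\<close>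

lemma axis_expansion: "a = (\<Sum>i\<in>UNIV. Re (a $ i) *\<^sub>R axis i 1 + Im (a $ i) *\<^sub>R axis i \<i>)"
  for a :: "complex^'n"
  by (simp add: vec_eq_iff axis_def complex_eq_iff if_distrib[of Re] if_distrib[of Im]
      if_distrib[of "(*) _"] cong: if_cong)

lemma linear_axis_expansion:
  fixes L :: "complex^'n \<Rightarrow> complex"
  assumes "linear L"
  shows "L a = (\<Sum>i\<in>UNIV. of_real (Re (a $ i)) * L (axis i 1) + of_real (Im (a $ i)) * L (axis i \<i>))"
  by (subst axis_expansion[of a])
     (simp only: linear_sum[OF assms] linear_add[OF assms] linear_cmul[OF assms], simp only: scaleR_conv_of_real)

text \<open>A real linear \<open>L\<close> is the sum of a complex linear and an antilinear map. The
  right-hand sides are the values of these two parts at \<open>a\<close>, the left-hand sides their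
  expansions in coordinates.\<close>

lemma wirtinger_sum:
  fixes L :: "complex^'n \<Rightarrow> complex"
  assumes "linear L"
  shows "(\<Sum>i\<in>UNIV. (L (axis i 1) - \<i> * L (axis i \<i>)) / 2 * a $ i) = (L a - \<i> * L (\<i> *s a)) / 2"
    and "(\<Sum>i\<in>UNIV. (L (axis i 1) + \<i> * L (axis i \<i>)) / 2 * cnj (a $ i)) = (L a + \<i> * L (\<i> *s a)) / 2"
proof -
  have "L (axis i 1) * a $ i - \<i> * L (axis i \<i>) * a $ i =
      (of_real (Re (a $ i)) * L (axis i 1) + of_real (Im (a $ i)) * L (axis i \<i>)) -
      \<i> * (of_real (Re (\<i> * a $ i)) * L (axis i 1) + of_real (Im (\<i> * a $ i)) * L (axis i \<i>))" for i
    by (simp add: complex_eq_iff algebra_simps)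
  then show "(\<Sum>i\<in>UNIV. (L (axis i 1) - \<i> * L (axis i \<i>)) / 2 * a $ i) = (L a - \<i> * L (\<i> *s a)) / 2"
    unfolding linear_axis_expansion[OF assms, of a] linear_axis_expansion[OF assms, of "\<i> *s a"]
    by (simp add: sum_distrib_left sum_subtractf[symmetric] sum_divide_distrib left_diff_distrib)
  have "L (axis i 1) * cnj (a $ i) + \<i> * L (axis i \<i>) * cnj (a $ i) =
      (of_real (Re (a $ i)) * L (axis i 1) + of_real (Im (a $ i)) * L (axis i \<i>)) +
      \<i> * (of_real (Re (\<i> * a $ i)) * L (axis i 1) + of_real (Im (\<i> * a $ i)) * L (axis i \<i>))" for i
    by (simp add: complex_eq_iff algebra_simps)
  then show "(\<Sum>i\<in>UNIV. (L (axis i 1) + \<i> * L (axis i \<i>)) / 2 * cnj (a $ i)) = (L a + \<i> * L (\<i> *s a)) / 2"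
    unfolding linear_axis_expansion[OF assms, of a] linear_axis_expansion[OF assms, of "\<i> *s a"]
    by (simp add: sum_distrib_left sum.distrib[symmetric] sum_divide_distrib distrib_right)
qed

lemma sum_dz:
  assumes "\<phi> differentiable (at z)"
  shows "(\<Sum>i\<in>UNIV. dz i \<phi> z * a $ i)
      = (frechet_derivative \<phi> (at z) a - \<i> * frechet_derivative \<phi> (at z) (\<i> *s a)) / 2"
    and "(\<Sum>i\<in>UNIV. dzbar i \<phi> z * cnj (a $ i))
      = (frechet_derivative \<phi> (at z) a + \<i> * frechet_derivative \<phi> (at z) (\<i> *s a)) / 2"
  unfolding dz_def dzbar_def
  by (rule wirtinger_sum[OF linear_frechet_derivative[OF assms]])+

abbreviation second_derivative ::
  "('a::real_normed_vector \<Rightarrow> 'b::real_normed_vector) \<Rightarrow> 'a \<Rightarrow> 'a \<Rightarrow> 'a \<Rightarrow> 'b" where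
  "second_derivative \<phi> z v e \<equiv> frechet_derivative (\<lambda>x. frechet_derivative \<phi> (at x) e) (at z) v"

lemma Ck_on_2D:
  assumes "Ck_on 2 \<phi> S" "z \<in> S"
  shows "\<phi> differentiable (at z)" "(\<lambda>x. frechet_derivative \<phi> (at x) e) differentiable (at z)"
  using assms by (auto simp: numeral_2_eq_2)

text \<open>In \<open>v\<close> this is the linearity of a derivative. In \<open>e\<close> it is the
  linearity of the first derivative at all points of the open set \<open>S\<close>, which passes
  under the outer derivative.\<close>

lemma linear_second_derivative:
  assumes S: "open S" "z \<in> S" and \<phi>: "Ck_on 2 \<phi> S"
  shows "linear (\<lambda>v. second_derivative \<phi> z v e)" "linear (\<lambda>e. second_derivative \<phi> z v e)"
proof -
  have d: "((\<lambda>x. frechet_derivative \<phi> (at x) e) has_derivative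
      frechet_derivative (\<lambda>x. frechet_derivative \<phi> (at x) e) (at z)) (at z)" for e
    using Ck_on_2D(2)[OF \<phi> S(2)] by (simp add: frechet_derivative_works[symmetric])
  show "linear (\<lambda>v. second_derivative \<phi> z v e)"
    using has_derivative_linear[OF d] .
  have lin: "linear (frechet_derivative \<phi> (at x))" if "x \<in> S" for x
    using Ck_on_2D(1)[OF \<phi> that] by (rule linear_frechet_derivative)
  show "linear (\<lambda>e. second_derivative \<phi> z v e)"
  proof (rule linearI)
    fix e e'
    have "frechet_derivative (\<lambda>x. frechet_derivative \<phi> (at x) (e + e')) (at z)
        = frechet_derivative (\<lambda>x. frechet_derivative \<phi> (at x) e + frechet_derivative \<phi> (at x) e') (at z)"
      by (rule frechet_derivative_cong_open[OF S]) (rule linear_add[OF lin])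
    also have "\<dots> = (\<lambda>v. second_derivative \<phi> z v e + second_derivative \<phi> z v e')"
      by (rule frechet_derivative_at[symmetric]) (rule has_derivative_add[OF d d])
    finally show "second_derivative \<phi> z v (e + e') = second_derivative \<phi> z v e + second_derivative \<phi> z v e'"
      by simp
  next
    fix r e
    have "frechet_derivative (\<lambda>x. frechet_derivative \<phi> (at x) (r *\<^sub>R e)) (at z)
        = frechet_derivative (\<lambda>x. r *\<^sub>R frechet_derivative \<phi> (at x) e) (at z)"
      by (rule frechet_derivative_cong_open[OF S]) (rule linear_cmul[OF lin])
    also have "\<dots> = (\<lambda>v. r *\<^sub>R second_derivative \<phi> z v e)"
      by (rule frechet_derivative_at[symmetric]) (rule has_derivative_scaleR_right[OF d])
    finally show "second_derivative \<phi> z v (r *\<^sub>R e) = r *\<^sub>R second_derivative \<phi> z v e"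
      by simp
  qed
qed

text \<open>On the complex line through \<open>z\<close> in direction \<open>a\<close> this is the
  identity of four times the mixed Wirtinger derivative with the Laplacian. The last summand is the
  commutator of the two real directions; it is carried along until \<open>levi_form\<close>.\<close>

lemma sum_dz_dzbar:
  fixes \<phi> :: "complex^'n \<Rightarrow> complex"
  assumes S: "open S" "z \<in> S" and \<phi>: "Ck_on 2 \<phi> S"
  shows "4 * (\<Sum>i\<in>UNIV. \<Sum>j\<in>UNIV. dz i (\<lambda>y. dzbar j (\<lambda>x. \<phi> x) y) z * a $ i * cnj (a $ j)) =
     second_derivative \<phi> z a a + second_derivative \<phi> z (\<i> *s a) (\<i> *s a)
     + \<i> * (second_derivative \<phi> z a (\<i> *s a) - second_derivative \<phi> z (\<i> *s a) a)"
proof -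
  define B where "B = (\<lambda>v e. second_derivative \<phi> z v e)"
  have arith: "4 * (((p + \<i> * q) / 2 - \<i> * ((r + \<i> * s) / 2)) / 2) = p + s + \<i> * (q - r)" for p q r s
    by (simp add: field_simps)
  have linB: "linear (B v)" for v
    unfolding B_def by (rule linear_second_derivative(2)[OF S \<phi>])
  have d: "((\<lambda>x. frechet_derivative \<phi> (at x) e) has_derivative (\<lambda>v. B v e)) (at z)" for e
    using Ck_on_2D(2)[OF \<phi> S(2)] by (simp add: B_def frechet_derivative_works[symmetric])
  have db: "((\<lambda>y. dzbar j \<phi> y) has_derivative (\<lambda>v. (B v (axis j 1) + \<i> * B v (axis j \<i>)) / 2)) (at z)" for j
    unfolding dzbar_def
    by (rule bounded_linear.has_derivative[OF bounded_linear_divide],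
        rule has_derivative_add[OF d], rule has_derivative_mult_right[OF d])
  \<comment> \<open>The sum over \<open>i\<close> extracts the complex linear part in the outer
    direction of differentiation; the sum over \<open>j\<close> will extract the antilinear part in
    the inner one.\<close>
  then have "(\<Sum>i\<in>UNIV. dz i (\<lambda>y. dzbar j \<phi> y) z * a $ i)
      = ((B a (axis j 1) + \<i> * B a (axis j \<i>)) / 2 - \<i> * ((B (\<i> *s a) (axis j 1) + \<i> * B (\<i> *s a) (axis j \<i>)) / 2)) / 2" for j
    using sum_dz(1)[OF differentiableI[OF db], of j a] by (simp add: frechet_derivative_at[OF db, symmetric])
  then have "(\<Sum>j\<in>UNIV. (\<Sum>i\<in>UNIV. dz i (\<lambda>y. dzbar j \<phi> y) z * a $ i) * cnj (a $ j)) =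
     ((\<Sum>j\<in>UNIV. (B a (axis j 1) + \<i> * B a (axis j \<i>)) / 2 * cnj (a $ j))
       - \<i> * (\<Sum>j\<in>UNIV. (B (\<i> *s a) (axis j 1) + \<i> * B (\<i> *s a) (axis j \<i>)) / 2 * cnj (a $ j))) / 2"
    by (simp add: sum_distrib_left sum_subtractf[symmetric] sum_divide_distrib left_diff_distrib
        diff_divide_distrib mult.assoc)
  also have "\<dots> = ((B a a + \<i> * B a (\<i> *s a)) / 2 - \<i> * ((B (\<i> *s a) a + \<i> * B (\<i> *s a) (\<i> *s a)) / 2)) / 2"
    by (simp only: wirtinger_sum(2)[OF linB])
  finally have "4 * (\<Sum>j\<in>UNIV. (\<Sum>i\<in>UNIV. dz i (\<lambda>y. dzbar j \<phi> y) z * a $ i) * cnj (a $ j))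
      = B a a + B (\<i> *s a) (\<i> *s a) + \<i> * (B a (\<i> *s a) - B (\<i> *s a) a)"
    by (simp only: arith)
  moreover have "(\<Sum>j\<in>UNIV. (\<Sum>i\<in>UNIV. dz i (\<lambda>y. dzbar j \<phi> y) z * a $ i) * cnj (a $ j))
      = (\<Sum>i\<in>UNIV. \<Sum>j\<in>UNIV. dz i (\<lambda>y. dzbar j \<phi> y) z * a $ i * cnj (a $ j))"
    unfolding sum_distrib_right by (rule sum.swap)
  ultimately show ?thesis by (simp add: B_def)
qed


section \<open>The Levi form of a Hermitian metric along a holomorphic curve\<close>

lemma jet2_vec:
  fixes f :: "real \<Rightarrow> complex^'n"
  assumes "\<And>i. jet2 (\<lambda>s. f s $ i) (p $ i) (q $ i)"
  shows "jet2 f p q"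
proof -
  have bl: "bounded_linear (axis i :: complex \<Rightarrow> complex^'n)" for i
    unfolding linear_conv_bounded_linear[symmetric]
    by (rule linearI) (simp_all add: axis_def vec_eq_iff)
  have e: "x = (\<Sum>i\<in>UNIV. axis i (x $ i))" for x :: "complex^'n"
    by (simp add: vec_eq_iff axis_def)
  have "jet2 (\<lambda>s. \<Sum>i\<in>UNIV. axis i (f s $ i)) (\<Sum>i\<in>UNIV. axis i (p $ i)) (\<Sum>i\<in>UNIV. axis i (q $ i))"
    by (rule jet2_sum, rule jet2_bounded_linear[OF bl], rule assms)
  then show ?thesis by (simp only: e[symmetric])
qed

text \<open>The derivative of the metric along the (1,0)-vector \<open>u\<close>, with
  \<open>v\<close> in its first slot; \<open>q\<close> is the remaining barred index.\<close>

definition grad_row :: "(complex^'n \<Rightarrow> complex^'n^'n) \<Rightarrow> complex^'n \<Rightarrow> complex^'n \<Rightarrow> complex^'n \<Rightarrow> complex^'n" where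
  "grad_row G z u v = (\<chi> q. \<Sum>k\<in>UNIV. (\<Sum>i\<in>UNIV. dz i (\<lambda>x. G x $ k $ q) z * u $ i) * v $ k)"

text \<open>The value that the derivative along \<open>u\<close> of a vector field with value \<open>v\<close> at \<open>z\<close> must have for the
  field to be parallel at \<open>z\<close> in the direction \<open>u\<close>, with respect to the Chern connection.\<close>

definition parallel_derivative :: "(complex^'n \<Rightarrow> complex^'n^'n) \<Rightarrow> complex^'n \<Rightarrow> complex^'n \<Rightarrow> complex^'n \<Rightarrow> complex^'n" where
  "parallel_derivative G z u v = (\<chi> p. - (\<Sum>q\<in>UNIV. grad_row G z u v $ q * matrix_inv (G z) $ q $ p))"

lemma local_metricD:
  assumes "local_metric G S"
  shows "open S" "Ck_on 2 (\<lambda>z. G z $ k $ l) S"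
    "z \<in> S \<Longrightarrow> G z $ l $ k = cnj (G z $ k $ l)" "z \<in> S \<Longrightarrow> x \<noteq> 0 \<Longrightarrow> Re (hform (G z) x x) > 0"
  using assms unfolding local_metric_def by blast+

lemma local_metric_nonneg:
  assumes "local_metric G S" "z \<in> S"
  shows "Re (hform (G z) x x) \<ge> 0"
  using local_metricD(4)[OF assms] by (cases "x = 0") (auto intro: less_imp_le)

text \<open>The inverse metric inside \<open>parallel_derivative\<close> cancels against
  \<open>G\<close>. The identity is the compatibility condition for a parallel field: changing
  \<open>v\<close> at this rate compensates the change of the metric along \<open>u\<close>,
  whatever \<open>w\<close> is.\<close>

lemma hform_parallel_derivative:
  assumes "local_metric G S" "z \<in> S"
  shows "hform (G z) (parallel_derivative G z u v) w = - (\<Sum>l\<in>UNIV. grad_row G z u v $ l * cnj (w $ l))"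
proof -
  let ?A = "grad_row G z u v"
  have inv: "matrix_inv (G z) ** G z = mat 1"
    using matrix_inv_mult_left pos_def_imp_invertible local_metricD(4)[OF assms] by blast
  have "(\<Sum>k\<in>UNIV. G z $ k $ l * parallel_derivative G z u v $ k) = - ?A $ l" for l
  proof -
    have "(\<Sum>k\<in>UNIV. G z $ k $ l * parallel_derivative G z u v $ k)
        = - (\<Sum>k\<in>UNIV. \<Sum>q\<in>UNIV. ?A $ q * (matrix_inv (G z) $ q $ k * G z $ k $ l))"
      by (simp add: parallel_derivative_def sum_distrib_left sum_negf[symmetric] ac_simps)
    also have "\<dots> = - (\<Sum>q\<in>UNIV. ?A $ q * (matrix_inv (G z) ** G z) $ q $ l)"
      unfolding matrix_matrix_mult_def by (subst sum.swap) (simp add: sum_distrib_left)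
    also have "\<dots> = - ?A $ l"
      unfolding inv by (simp add: mat_def if_distrib[of "(*) _"] cong: if_cong)
    finally show ?thesis .
  qed
  then show ?thesis
    unfolding hform_def
    by (subst sum.swap) (simp add: sum_distrib_right[symmetric] sum_negf[symmetric])
qed

text \<open>Hermitian symmetry holds on the open set \<open>S\<close>, so it can be differentiated;
  conjugation then exchanges \<open>dz\<close> with \<open>dzbar\<close> and swaps the two matrix
  indices.\<close>

lemma grad_row_cnj:
  assumes G: "local_metric G S" and z: "z \<in> S"
  shows "(\<Sum>l\<in>UNIV. (\<Sum>j\<in>UNIV. dzbar j (\<lambda>x. G x $ p $ l) z * cnj (u $ j)) * cnj (v $ l)) = cnj (grad_row G z u v $ p)"
proof -
  have "dzbar j (\<lambda>x. G x $ p $ l) z = cnj (dz j (\<lambda>x. G x $ l $ p) z)" for j l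
  proof -
    have "frechet_derivative (\<lambda>x. G x $ p $ l) (at z) = frechet_derivative (\<lambda>x. cnj (G x $ l $ p)) (at z)"
      by (rule frechet_derivative_cong_open[OF local_metricD(1)[OF G] z]) (rule local_metricD(3)[OF G])
    then show ?thesis
      by (simp add: dz_def dzbar_def frechet_derivative_cnj[OF Ck_on_2D(1)[OF local_metricD(2)[OF G] z]])
  qed
  then show ?thesis by (simp add: grad_row_def)
qed

text \<open>The new order lets the sums over \<open>i\<close> and \<open>k\<close> fold into an
  entry of \<open>grad_row\<close>, and those over \<open>j\<close> and \<open>l\<close> into the
  conjugate of another entry.\<close>

lemma sum6_reorder:
  fixes f :: "'i::finite \<Rightarrow> 'j::finite \<Rightarrow> 'k::finite \<Rightarrow> 'l::finite \<Rightarrow> 'p::finite \<Rightarrow> 'q::finite \<Rightarrow> complex"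
  shows "(\<Sum>i\<in>UNIV. \<Sum>j\<in>UNIV. \<Sum>k\<in>UNIV. \<Sum>l\<in>UNIV. \<Sum>p\<in>UNIV. \<Sum>q\<in>UNIV. f i j k l p q)
    = (\<Sum>p\<in>UNIV. \<Sum>q\<in>UNIV. \<Sum>l\<in>UNIV. \<Sum>j\<in>UNIV. \<Sum>k\<in>UNIV. \<Sum>i\<in>UNIV. f i j k l p q)"
  unfolding sum.cartesian_product
  by (rule sum.reindex_bij_witness[where i="\<lambda>(p,q,l,j,k,i). (i,j,k,l,p,q)" and j="\<lambda>(i,j,k,l,p,q). (p,q,l,j,k,i)"]) auto

lemma sum4_reorder:
  fixes f :: "'i::finite \<Rightarrow> 'j::finite \<Rightarrow> 'k::finite \<Rightarrow> 'l::finite \<Rightarrow> complex"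
  shows "(\<Sum>i\<in>UNIV. \<Sum>j\<in>UNIV. \<Sum>k\<in>UNIV. \<Sum>l\<in>UNIV. f i j k l)
    = (\<Sum>k\<in>UNIV. \<Sum>l\<in>UNIV. \<Sum>i\<in>UNIV. \<Sum>j\<in>UNIV. f i j k l)"
  unfolding sum.cartesian_product
  by (rule sum.reindex_bij_witness[where i="\<lambda>(k,l,i,j). (i,j,k,l)" and j="\<lambda>(i,j,k,l). (k,l,i,j)"]) auto

text \<open>The first-order part of the curvature is the squared length of \<open>grad_row\<close>
  in the inverse metric, which equals the squared length of \<open>parallel_derivative\<close> in
  \<open>G\<close>. The \<open>cnj\<close> reflects the order of contraction; the number is
  real.\<close>

lemma chern_form_eq:
  fixes G :: "complex^'n \<Rightarrow> complex^'n^'n"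
  assumes G: "local_metric G S" and z: "z \<in> S"
  shows "chern_form G z u v =
    - (\<Sum>k\<in>UNIV. \<Sum>l\<in>UNIV. (\<Sum>i\<in>UNIV. \<Sum>j\<in>UNIV. dz i (\<lambda>y. dzbar j (\<lambda>x. G x $ k $ l) y) z * u $ i * cnj (u $ j)) * v $ k * cnj (v $ l))
    + cnj (hform (G z) (parallel_derivative G z u v) (parallel_derivative G z u v))"
proof -
  let ?A = "grad_row G z u v"
  let ?b = "parallel_derivative G z u v"
  have "(\<Sum>i\<in>UNIV. \<Sum>j\<in>UNIV. \<Sum>k\<in>UNIV. \<Sum>l\<in>UNIV. (\<Sum>p\<in>UNIV. \<Sum>q\<in>UNIV. matrix_inv (G z) $ q $ p *
          dz i (\<lambda>x. G x $ k $ q) z * dzbar j (\<lambda>x. G x $ p $ l) z) * u $ i * cnj (u $ j) * v $ k * cnj (v $ l))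
     = (\<Sum>i\<in>UNIV. \<Sum>j\<in>UNIV. \<Sum>k\<in>UNIV. \<Sum>l\<in>UNIV. \<Sum>p\<in>UNIV. \<Sum>q\<in>UNIV. matrix_inv (G z) $ q $ p *
          ((dz i (\<lambda>x. G x $ k $ q) z * u $ i * v $ k) * (dzbar j (\<lambda>x. G x $ p $ l) z * cnj (u $ j) * cnj (v $ l))))"
    by (simp only: sum_distrib_left sum_distrib_right ac_simps)
  also have "\<dots> = (\<Sum>p\<in>UNIV. \<Sum>q\<in>UNIV. \<Sum>l\<in>UNIV. \<Sum>j\<in>UNIV. \<Sum>k\<in>UNIV. \<Sum>i\<in>UNIV. matrix_inv (G z) $ q $ p *
          ((dz i (\<lambda>x. G x $ k $ q) z * u $ i * v $ k) * (dzbar j (\<lambda>x. G x $ p $ l) z * cnj (u $ j) * cnj (v $ l))))"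
    by (rule sum6_reorder)
  also have "\<dots> = (\<Sum>p\<in>UNIV. \<Sum>q\<in>UNIV. matrix_inv (G z) $ q $ p *
      (?A $ q * (\<Sum>l\<in>UNIV. (\<Sum>j\<in>UNIV. dzbar j (\<lambda>x. G x $ p $ l) z * cnj (u $ j)) * cnj (v $ l))))"
    by (simp only: grad_row_def vec_lambda_beta sum_distrib_left sum_distrib_right)
  also have "\<dots> = (\<Sum>p\<in>UNIV. \<Sum>q\<in>UNIV. matrix_inv (G z) $ q $ p * (?A $ q * cnj (?A $ p)))"
    by (simp only: grad_row_cnj[OF G z])
  also have "\<dots> = - (\<Sum>p\<in>UNIV. ?b $ p * cnj (?A $ p))"
    by (simp add: parallel_derivative_def sum_distrib_left sum_distrib_right sum_negf ac_simps)
  also have "\<dots> = cnj (hform (G z) ?b ?b)"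
    unfolding hform_parallel_derivative[OF G z] by (simp add: mult.commute)
  finally have 1: "(\<Sum>i\<in>UNIV. \<Sum>j\<in>UNIV. \<Sum>k\<in>UNIV. \<Sum>l\<in>UNIV. (\<Sum>p\<in>UNIV. \<Sum>q\<in>UNIV. matrix_inv (G z) $ q $ p *
          dz i (\<lambda>x. G x $ k $ q) z * dzbar j (\<lambda>x. G x $ p $ l) z) * u $ i * cnj (u $ j) * v $ k * cnj (v $ l))
      = cnj (hform (G z) ?b ?b)" .
  have 2: "(\<Sum>i\<in>UNIV. \<Sum>j\<in>UNIV. \<Sum>k\<in>UNIV. \<Sum>l\<in>UNIV. dz i (\<lambda>y. dzbar j (\<lambda>x. G x $ k $ l) y) z * u $ i * cnj (u $ j) * v $ k * cnj (v $ l))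
     = (\<Sum>k\<in>UNIV. \<Sum>l\<in>UNIV. (\<Sum>i\<in>UNIV. \<Sum>j\<in>UNIV. dz i (\<lambda>y. dzbar j (\<lambda>x. G x $ k $ l) y) z * u $ i * cnj (u $ j)) * v $ k * cnj (v $ l))"
    by (simp only: sum4_reorder[of "\<lambda>i j k l. dz i (\<lambda>y. dzbar j (\<lambda>x. G x $ k $ l) y) z * u $ i * cnj (u $ j) * v $ k * cnj (v $ l)"] sum_distrib_right)
  show ?thesis
    unfolding chern_form_def chern_component_def distrib_right sum.distrib 1
    by (simp only: 2[symmetric] mult_minus_left sum_negf)
qed

text \<open>Bochner-type formula for the squared length of a holomorphic field \<open>W\<close>
  along a holomorphic curve \<open>\<gamma>\<close>. \<open>q 1 + q \<i>\<close> is its Laplacian at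
  0, and \<open>B - parallel_derivative ...\<close> is the Chern covariant derivative of
  \<open>W\<close> there.\<close>

lemma levi_form:
  fixes G :: "complex^'n \<Rightarrow> complex^'n^'n" and \<gamma> W :: "complex \<Rightarrow> complex^'n"
  assumes G: "local_metric G S" and T: "open T" "0 \<in> T"
    and \<gamma>: "\<And>i. (\<lambda>t. \<gamma> t $ i) holomorphic_on T" and W: "\<And>i. (\<lambda>t. W t $ i) holomorphic_on T"
    and z: "\<gamma> 0 \<in> S"
    and a: "a = (\<chi> i. deriv (\<lambda>t. \<gamma> t $ i) 0)" and B: "B = (\<chi> i. deriv (\<lambda>t. W t $ i) 0)"
  obtains p q where "\<And>\<theta>. jet2 (\<lambda>s. Re (hform (G (\<gamma> (of_real s * \<theta>))) (W (of_real s * \<theta>)) (W (of_real s * \<theta>)))) (p \<theta>) (q \<theta>)"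
    "q 1 + q \<i> = 4 * (Re (hform (G (\<gamma> 0)) (B - parallel_derivative G (\<gamma> 0) a (W 0)) (B - parallel_derivative G (\<gamma> 0) a (W 0)))
       - Re (chern_form G (\<gamma> 0) a (W 0)))"
proof -
  define z where "z = \<gamma> 0"
  define w where "w = W 0"
  define a2 where "a2 = (\<chi> i. deriv (deriv (\<lambda>t. \<gamma> t $ i)) 0)"
  define B2 where "B2 = (\<chi> i. deriv (deriv (\<lambda>t. W t $ i)) 0)"
  have zS: "z \<in> S" using assms(6) by (simp add: z_def)
  define D where "D = (\<lambda>k l. frechet_derivative (\<lambda>x. G x $ k $ l) (at z))"
  define H where "H = (\<lambda>k l v e. second_derivative (\<lambda>x. G x $ k $ l) z v e)"
  note C2 = local_metricD(2)[OF G]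
  note S = local_metricD(1)[OF G]
  have linD: "linear (D k l)" for k l
    unfolding D_def by (rule linear_frechet_derivative[OF Ck_on_2D(1)[OF C2 zS]])
  have j\<gamma>: "jet2 (\<lambda>s. \<gamma> (of_real s * \<theta>)) (\<theta> *s a) (\<theta>\<^sup>2 *s a2)" for \<theta>
    by (rule jet2_vec) (simp add: a a2_def jet2_holomorphic[OF \<gamma> T])
  have jW: "jet2 (\<lambda>s. W (of_real s * \<theta>) $ k) (\<theta> * B $ k) (\<theta>\<^sup>2 * B2 $ k)" for \<theta> k
    by (simp add: B B2_def jet2_holomorphic[OF W T])
  have jG: "jet2 (\<lambda>s. G (\<gamma> (of_real s * \<theta>)) $ k $ l) (D k l (\<theta> *s a)) (H k l (\<theta> *s a) (\<theta> *s a) + D k l (\<theta>\<^sup>2 *s a2))" for \<theta> k l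
    using jet2_compose[OF S C2[of k l] _ j\<gamma>[of \<theta>]] zS by (simp add: D_def H_def z_def)
  define p where "p = (\<lambda>\<theta> k l. G z $ k $ l * w $ k * cnj (\<theta> * B $ l) + (G z $ k $ l * (\<theta> * B $ k) + D k l (\<theta> *s a) * w $ k) * cnj (w $ l))"
  define q where "q = (\<lambda>\<theta> k l. G z $ k $ l * w $ k * cnj (\<theta>\<^sup>2 * B2 $ l)
      + 2 * (G z $ k $ l * (\<theta> * B $ k) + D k l (\<theta> *s a) * w $ k) * cnj (\<theta> * B $ l)
      + (G z $ k $ l * (\<theta>\<^sup>2 * B2 $ k) + 2 * D k l (\<theta> *s a) * (\<theta> * B $ k)
         + (H k l (\<theta> *s a) (\<theta> *s a) + D k l (\<theta>\<^sup>2 *s a2)) * w $ k) * cnj (w $ l))"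
  have entry: "jet2 (\<lambda>s. G (\<gamma> (of_real s * \<theta>)) $ k $ l * W (of_real s * \<theta>) $ k * cnj (W (of_real s * \<theta>) $ l)) (p \<theta> k l) (q \<theta> k l)" for \<theta> k l
    using jet2_mult[OF jet2_mult[OF jG[of \<theta> k l] jW[of \<theta> k]] jet2_bounded_linear[OF bounded_linear_cnj jW[of \<theta> l]]]
    by (simp add: p_def q_def z_def w_def)
  have "jet2 (\<lambda>s. Re (hform (G (\<gamma> (of_real s * \<theta>))) (W (of_real s * \<theta>)) (W (of_real s * \<theta>))))
      (Re (\<Sum>k\<in>UNIV. \<Sum>l\<in>UNIV. p \<theta> k l)) (Re (\<Sum>k\<in>UNIV. \<Sum>l\<in>UNIV. q \<theta> k l))" for \<theta>
    unfolding hform_def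
    by (rule jet2_bounded_linear[OF bounded_linear_Re], rule jet2_sum, rule jet2_sum, rule entry)
  moreover have "Re (\<Sum>k\<in>UNIV. \<Sum>l\<in>UNIV. q 1 k l) + Re (\<Sum>k\<in>UNIV. \<Sum>l\<in>UNIV. q \<i> k l)
      = 4 * (Re (hform (G z) (B - parallel_derivative G z a w) (B - parallel_derivative G z a w)) - Re (chern_form G z a w))"
  proof -
    let ?b = "parallel_derivative G z a w"
    let ?A = "grad_row G z a w"
    define d where "d = (\<lambda>k l. \<Sum>i\<in>UNIV. dz i (\<lambda>x. G x $ k $ l) z * a $ i)"
    define d' where "d' = (\<lambda>k l. \<Sum>i\<in>UNIV. dzbar i (\<lambda>x. G x $ k $ l) z * cnj (a $ i))"
    define dd where "dd = (\<lambda>k l. \<Sum>i\<in>UNIV. \<Sum>j\<in>UNIV. dz i (\<lambda>y. dzbar j (\<lambda>x. G x $ k $ l) y) z * a $ i * cnj (a $ j))"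
    define c where "c = (\<lambda>k l. H k l a (\<i> *s a) - H k l (\<i> *s a) a)"
    have d: "D k l a - \<i> * D k l (\<i> *s a) = 2 * d k l" and d': "D k l a + \<i> * D k l (\<i> *s a) = 2 * d' k l" for k l
      unfolding d_def d'_def D_def sum_dz[OF Ck_on_2D(1)[OF C2 zS]] by simp_all
    have dd: "H k l a a + H k l (\<i> *s a) (\<i> *s a) = 4 * dd k l - \<i> * c k l" for k l
      unfolding dd_def c_def H_def sum_dz_dzbar[OF S zS C2] by simp
    \<comment> \<open>For \<open>\<theta> = \<i>\<close> the curve has acceleration
      \<open>- a2\<close>, so the terms in \<open>a2\<close> cancel between the two directions, as
      do those in \<open>B2\<close>.\<close>
    have neg: "D k l (- a2) = - D k l a2" for k l by (rule linear_neg[OF linD])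
    have one: "(1::complex) *s x = x" "(-1::complex) *s x = - x" for x :: "complex^'n"
      by (simp_all add: vec_eq_iff)
    \<comment> \<open>Adding the directions 1 and \<open>\<i>\<close> keeps, besides the commutator
      \<open>c\<close>, the terms with one holomorphic and one antiholomorphic derivative.\<close>
    have qq: "q 1 k l + q \<i> k l = 4 * (dd k l * w $ k * cnj (w $ l)) - \<i> * (c k l * w $ k * cnj (w $ l))
        + 4 * (d k l * w $ k * cnj (B $ l)) + 4 * (d' k l * cnj (w $ l) * B $ k) + 4 * (G z $ k $ l * B $ k * cnj (B $ l))" for k l
    proof -
      have "q 1 k l + q \<i> k l = (H k l a a + H k l (\<i> *s a) (\<i> *s a)) * w $ k * cnj (w $ l)
          + 2 * (D k l a - \<i> * D k l (\<i> *s a)) * w $ k * cnj (B $ l)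
          + 2 * (D k l a + \<i> * D k l (\<i> *s a)) * B $ k * cnj (w $ l) + 4 * (G z $ k $ l * B $ k * cnj (B $ l))"
        unfolding q_def by (simp add: one neg algebra_simps)
      then show ?thesis unfolding d d' dd by (simp add: algebra_simps)
    qed
    have Hc: "H l k v e = cnj (H k l v e)" for k l v e
    proof -
      have 1: "frechet_derivative (\<lambda>x. G x $ l $ k) (at x) e = cnj (frechet_derivative (\<lambda>x. G x $ k $ l) (at x) e)" if "x \<in> S" for x
        unfolding frechet_derivative_cnj[OF Ck_on_2D(1)[OF C2 that], symmetric]
        by (rule arg_cong[where f="\<lambda>f. f e"], rule frechet_derivative_cong_open[OF S that]) (rule local_metricD(3)[OF G])
      show ?thesis
        unfolding H_def frechet_derivative_cnj[OF Ck_on_2D(2)[OF C2 zS], symmetric]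
        by (rule arg_cong[where f="\<lambda>f. f v"], rule frechet_derivative_cong_open[OF S zS]) (rule 1)
    qed
    \<comment> \<open>The commutators \<open>c k l\<close> of second derivatives vanish by Schwarz's theorem, but it is enough that they form
      a Hermitian matrix: then they do not contribute to the real part.\<close>
    have cc: "c l k = cnj (c k l)" for k l
      unfolding c_def complex_cnj_diff Hc[symmetric] by (rule refl)
    have "cnj (hform (\<chi> k l. c k l) w w) = hform (\<chi> k l. c k l) w w"
      by (rule hform_cnj[symmetric]) (simp only: vec_lambda_beta cc[symmetric])
    then have "Im (hform (\<chi> k l. c k l) w w) = 0"
      by (metis Reals_cnj_iff complex_is_Real_iff)
    then have Cim: "Im (\<Sum>k\<in>UNIV. \<Sum>l\<in>UNIV. c k l * w $ k * cnj (w $ l)) = 0"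
      by (simp only: hform_def vec_lambda_beta)
    have A: "(\<Sum>k\<in>UNIV. \<Sum>l\<in>UNIV. d k l * w $ k * cnj (B $ l)) = (\<Sum>l\<in>UNIV. ?A $ l * cnj (B $ l))"
      by (subst sum.swap) (simp add: grad_row_def d_def sum_distrib_right)
    have A': "(\<Sum>k\<in>UNIV. \<Sum>l\<in>UNIV. d' k l * cnj (w $ l) * B $ k) = (\<Sum>k\<in>UNIV. cnj (?A $ k) * B $ k)"
      unfolding grad_row_cnj[OF G zS, symmetric] d'_def by (simp only: sum_distrib_right)
    have "(\<Sum>k\<in>UNIV. \<Sum>l\<in>UNIV. q 1 k l) + (\<Sum>k\<in>UNIV. \<Sum>l\<in>UNIV. q \<i> k l) =
       4 * (\<Sum>k\<in>UNIV. \<Sum>l\<in>UNIV. dd k l * w $ k * cnj (w $ l)) - \<i> * (\<Sum>k\<in>UNIV. \<Sum>l\<in>UNIV. c k l * w $ k * cnj (w $ l))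
       + 4 * (\<Sum>l\<in>UNIV. ?A $ l * cnj (B $ l)) + 4 * (\<Sum>k\<in>UNIV. cnj (?A $ k) * B $ k) + 4 * hform (G z) B B"
      unfolding sum.distrib[symmetric] qq hform_def A[symmetric] A'[symmetric] sum_distrib_left sum_subtractf[symmetric] by simp
    then have *: "Re (\<Sum>k\<in>UNIV. \<Sum>l\<in>UNIV. q 1 k l) + Re (\<Sum>k\<in>UNIV. \<Sum>l\<in>UNIV. q \<i> k l) =
       4 * Re (\<Sum>k\<in>UNIV. \<Sum>l\<in>UNIV. dd k l * w $ k * cnj (w $ l))
       + 4 * Re (\<Sum>l\<in>UNIV. ?A $ l * cnj (B $ l)) + 4 * Re (\<Sum>k\<in>UNIV. cnj (?A $ k) * B $ k) + 4 * Re (hform (G z) B B)"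
      using Cim by (simp add: complex_eq_iff del: Re_sum Im_sum)
    have cA: "(\<Sum>k\<in>UNIV. cnj (?A $ k) * B $ k) = cnj (\<Sum>l\<in>UNIV. ?A $ l * cnj (B $ l))" by simp
    have bB: "(\<Sum>l\<in>UNIV. ?A $ l * cnj (B $ l)) = - hform (G z) ?b B"
      unfolding hform_parallel_derivative[OF G zS] by simp
    have Bb: "hform (G z) B ?b = cnj (hform (G z) ?b B)"
      by (rule hform_cnj) (rule local_metricD(3)[OF G zS])
    have ch: "chern_form G z a w = - (\<Sum>k\<in>UNIV. \<Sum>l\<in>UNIV. dd k l * w $ k * cnj (w $ l)) + cnj (hform (G z) ?b ?b)"
      unfolding dd_def by (rule chern_form_eq[OF G zS])
    \<comment> \<open>Completing the square: with \<open>b\<close> the parallel derivative, the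
      cross terms give \<open>- 2 * Re (hform (G z) ?b B)\<close>, and the missing squared length of
      \<open>b\<close> is the first-order part of the curvature.\<close>
    show ?thesis
      unfolding * ch cA bB hform_diff_left hform_diff_right Bb
      by (simp del: Re_sum Im_sum)
  qed
  ultimately show ?thesis
    using that[of "\<lambda>\<theta>. Re (\<Sum>k\<in>UNIV. \<Sum>l\<in>UNIV. p \<theta> k l)" "\<lambda>\<theta>. Re (\<Sum>k\<in>UNIV. \<Sum>l\<in>UNIV. q \<theta> k l)"] by (simp add: z_def w_def del: Re_sum Im_sum)
qed

section \<open>Comparison of the two curvatures at a maximum\<close>

text \<open>The inequality \<open>le\<close> is used along the field \<open>x0 + t *s b\<close>,
  hence at neighbouring points and for vectors other than \<open>x0\<close>; equality is used only
  at \<open>t = 0\<close>. The direction \<open>u\<close> is arbitrary, and \<open>b\<close> depends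
  on it.\<close>

lemma chern_form_le_of_maximum:
  fixes G :: "complex^'m \<Rightarrow> complex^'m^'m" and H :: "complex^'n \<Rightarrow> complex^'n^'n"
  assumes G: "local_metric G S" and H: "local_metric H T"
    and F: "mv_holomorphic_on F S" and FT: "F ` S \<subseteq> T" and z0: "z0 \<in> S"
    and le: "\<And>z x. z \<in> S \<Longrightarrow>
      Re (hform (H (F z)) (frechet_derivative F (at z) x) (frechet_derivative F (at z) x)) \<le> c * Re (hform (G z) x x)"
    and eq: "Re (hform (H (F z0)) (frechet_derivative F (at z0) x0) (frechet_derivative F (at z0) x0))
      = c * Re (hform (G z0) x0 x0)"
  shows "c * Re (chern_form G z0 u x0)
    \<le> Re (chern_form H (F z0) (frechet_derivative F (at z0) u) (frechet_derivative F (at z0) x0))"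
proof -
  define D where "D = (\<lambda>z. frechet_derivative F (at z))"
  define b where "b = parallel_derivative G z0 u x0"
  define U where "U = {t. z0 + t *s u \<in> S}"
  note S = local_metricD(1)[OF G]
  have U: "open U" "0 \<in> U" using open_complex_line[OF S] z0 by (auto simp: U_def)
  define V where "V = (\<lambda>t. x0 + t *s b)"
  define W where "W = (\<lambda>t. D (z0 + t *s u) (V t))"
  obtain pG qG where
    jG: "\<And>\<theta>. jet2 (\<lambda>s. Re (hform (G (z0 + (of_real s * \<theta>) *s u)) (V (of_real s * \<theta>)) (V (of_real s * \<theta>)))) (pG \<theta>) (qG \<theta>)"
    and qG: "qG 1 + qG \<i> = 4 * (Re (hform (G (z0 + 0 *s u)) (b - parallel_derivative G (z0 + 0 *s u) u (V 0)) (b - parallel_derivative G (z0 + 0 *s u) u (V 0)))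
       - Re (chern_form G (z0 + 0 *s u) u (V 0)))"
  proof (rule levi_form[OF G U, of "\<lambda>t. z0 + t *s u" V u b])
    show "(\<lambda>t. (z0 + t *s u) $ i) holomorphic_on U" "(\<lambda>t. V t $ i) holomorphic_on U" for i
      unfolding V_def vector_add_component vector_smult_component by (intro holomorphic_intros)+
    have "deriv (\<lambda>t. a + t * d) 0 = d" for a d :: complex
      by (rule DERIV_imp_deriv) (auto intro!: derivative_eq_intros)
    then show "u = (\<chi> i. deriv (\<lambda>t. (z0 + t *s u) $ i) 0)" "b = (\<chi> i. deriv (\<lambda>t. V t $ i) 0)"
      by (simp_all add: V_def vec_eq_iff)
  qed (use z0 in simp, rule that)
  define B where "B = (\<chi> i. deriv (\<lambda>t. W t $ i) 0)"
  obtain pH qH where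
    jH: "\<And>\<theta>. jet2 (\<lambda>s. Re (hform (H (F (z0 + (of_real s * \<theta>) *s u))) (W (of_real s * \<theta>)) (W (of_real s * \<theta>)))) (pH \<theta>) (qH \<theta>)"
    and qH: "qH 1 + qH \<i> = 4 * (Re (hform (H (F (z0 + 0 *s u))) (B - parallel_derivative H (F (z0 + 0 *s u)) (D z0 u) (W 0)) (B - parallel_derivative H (F (z0 + 0 *s u)) (D z0 u) (W 0)))
       - Re (chern_form H (F (z0 + 0 *s u)) (D z0 u) (W 0)))"
  proof (rule levi_form[OF H U, of "\<lambda>t. F (z0 + t *s u)" W "D z0 u" B])
    show "(\<lambda>t. F (z0 + t *s u) $ i) holomorphic_on U" for i
      unfolding U_def by (rule mv_holomorphic_on_line_holomorphic[OF F S])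
    show "(\<lambda>t. W t $ i) holomorphic_on U" for i
    proof -
      \<comment> \<open>Complex linearity splits the pushed-forward field into derivatives in the
        fixed directions \<open>x0\<close> and \<open>b\<close>, both holomorphic along the line in
        direction \<open>u\<close>.\<close>
      have "(\<lambda>t. D (z0 + t *s u) x0 $ i + t * D (z0 + t *s u) b $ i) holomorphic_on U"
        unfolding U_def D_def by (intro holomorphic_intros mv_holomorphic_on_derivative_line_holomorphic_on[OF F S])
      moreover have "W t $ i = D (z0 + t *s u) x0 $ i + t * D (z0 + t *s u) b $ i" if "t \<in> U" for t
        using that by (simp add: W_def V_def D_def U_def mv_holomorphic_on_derivative_add[OF F] mv_holomorphic_on_derivative_smult[OF F])
      ultimately show ?thesis by (simp cong: holomorphic_cong)
    qed
    show "D z0 u = (\<chi> i. deriv (\<lambda>t. F (z0 + t *s u) $ i) 0)"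
      using DERIV_imp_deriv[OF mv_holomorphic_on_line_derivative[OF F, of z0 0 u]] z0
      by (simp add: vec_eq_iff D_def)
  qed (use z0 FT in force, simp only: B_def, rule that)
  have max: "qH \<theta> \<le> c * qG \<theta>" for \<theta>
  proof -
    let ?f = "\<lambda>s::real. Re (hform (H (F (z0 + (of_real s * \<theta>) *s u))) (W (of_real s * \<theta>)) (W (of_real s * \<theta>)))
      + (- c) * Re (hform (G (z0 + (of_real s * \<theta>) *s u)) (V (of_real s * \<theta>)) (V (of_real s * \<theta>)))"
    have "jet2 ?f (pH \<theta> + (- c) * pG \<theta>) (qH \<theta> + (- c) * qG \<theta>)"
      by (rule jet2_add[OF jH jet2_bounded_linear[OF bounded_linear_mult_right jG]])
    moreover have "\<forall>\<^sub>F s in nhds 0. ?f s \<le> ?f 0"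
    proof -
      have "((\<lambda>s::real. of_real s * \<theta>) \<longlongrightarrow> of_real 0 * \<theta>) (nhds 0)"
        by (rule tendsto_mult[OF tendsto_of_real[OF filterlim_ident] tendsto_const])
      then have "\<forall>\<^sub>F s::real in nhds 0. of_real s * \<theta> \<in> U"
        by (rule topological_tendstoD) (use U in simp_all)
      then show ?thesis
      proof eventually_elim
        case (elim s)
        have le0: "?f s \<le> 0" using elim le by (simp add: U_def W_def D_def)
        have "?f 0 = 0" using eq by (simp add: W_def V_def D_def)
        then show ?case using le0 by (simp only:)
      qed
    qed
    ultimately show ?thesis using jet2_local_max by fastforce
  qed
  have W0: "W 0 = D z0 x0" by (simp add: W_def V_def)
  \<comment> \<open>\<open>B\<close> is the unknown derivative of the pushed-forward field; it
    occurs only in this squared length, so nonnegativity suffices.\<close>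
  have "0 \<le> Re (hform (H (F (z0 + 0 *s u))) (B - parallel_derivative H (F (z0 + 0 *s u)) (D z0 u) (W 0)) (B - parallel_derivative H (F (z0 + 0 *s u)) (D z0 u) (W 0)))"
    by (rule local_metric_nonneg[OF H]) (use z0 FT in auto)
  then have "- 4 * Re (chern_form H (F z0) (D z0 u) (D z0 x0)) \<le> qH 1 + qH \<i>"
    using qH W0 by simp
  also have "\<dots> \<le> c * (qG 1 + qG \<i>)" using max[of 1] max[of \<i>] by (simp add: distrib_left)
  also have "\<dots> = - 4 * (c * Re (chern_form G z0 u x0))"
    unfolding qG by (simp add: V_def b_def)
  finally show ?thesis by (simp add: D_def)
qed


section \<open>Charts, tangent vectors and metrics\<close>

lemma is_chart_inverse:
  assumes "is_chart X c"
  shows "p \<in> chart_dom c \<Longrightarrow> chart_inv c (chart_map c p) = p"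
    and "z \<in> chart_ran c \<Longrightarrow> chart_inv c z \<in> chart_dom c"
    and "z \<in> chart_ran c \<Longrightarrow> chart_map c (chart_inv c z) = z"
    and "inj_on (chart_map c) (chart_dom c)"
proof -
  have "topspace (subtopology X (chart_dom c)) = chart_dom c"
    using assms openin_subset unfolding is_chart_def by (auto simp: topspace_subtopology)
  then show inj: "inj_on (chart_map c) (chart_dom c)"
    using assms homeomorphic_imp_injective_map unfolding is_chart_def by metis
  show "p \<in> chart_dom c \<Longrightarrow> chart_inv c (chart_map c p) = p"
    unfolding chart_inv_def by (rule inv_into_f_f[OF inj])
  show "z \<in> chart_ran c \<Longrightarrow> chart_inv c z \<in> chart_dom c"
    unfolding chart_inv_def by (rule inv_into_into)
  show "z \<in> chart_ran c \<Longrightarrow> chart_map c (chart_inv c z) = z"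
    unfolding chart_inv_def by (rule f_inv_into_f)
qed

lemma is_chart_open_image:
  assumes "is_chart X c" "openin X U" "U \<subseteq> chart_dom c"
  shows "open (chart_map c ` U)"
proof -
  have "open_map (subtopology X (chart_dom c)) (top_of_set (chart_ran c)) (chart_map c)"
    using assms(1) homeomorphic_imp_open_map unfolding is_chart_def by blast
  moreover have "openin (subtopology X (chart_dom c)) U"
    using assms by (auto simp: openin_subtopology)
  ultimately have "openin (top_of_set (chart_ran c)) (chart_map c ` U)"
    unfolding open_map_def by blast
  then show ?thesis
    using assms(1) openin_open_trans unfolding is_chart_def by blast
qed

lemma is_chart_open_preimage:
  assumes "is_chart X c" "open V"
  shows "openin X {p \<in> chart_dom c. chart_map c p \<in> V}"
proof -
  have *: "openin X (chart_dom c)" using assms(1) unfolding is_chart_def by blast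
  have "continuous_map (subtopology X (chart_dom c)) (top_of_set (chart_ran c)) (chart_map c)"
    using assms(1) homeomorphic_imp_continuous_map unfolding is_chart_def by blast
  then have "continuous_map (subtopology X (chart_dom c)) euclidean (chart_map c)"
    by (rule continuous_map_into_fulltopology)
  from openin_continuous_map_preimage[OF this, of V]
  have "openin (subtopology X (chart_dom c)) {p \<in> topspace X \<inter> chart_dom c. chart_map c p \<in> V}"
    using assms(2) by simp
  then have "openin X {p \<in> topspace X \<inter> chart_dom c. chart_map c p \<in> V}"
    using * openin_trans_full by blast
  moreover have "topspace X \<inter> chart_dom c = chart_dom c"
    using openin_subset[OF *] by blast
  ultimately show ?thesis by simp
qed

text \<open>Stated for a \<open>K\<close> that agrees with the composite only near \<open>z\<close>,
  because identities between transition maps hold only on overlaps of charts.\<close>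

lemma frechet_derivative_chain:
  assumes "F differentiable (at z)" "G differentiable (at (F z))"
    and U: "open U" "z \<in> U" "\<And>y. y \<in> U \<Longrightarrow> G (F y) = K y"
  shows "frechet_derivative K (at z) x = frechet_derivative G (at (F z)) (frechet_derivative F (at z) x)"
proof -
  have "((\<lambda>y. G (F y)) has_derivative (\<lambda>x. frechet_derivative G (at (F z)) (frechet_derivative F (at z) x))) (at z)"
    using assms(1,2) unfolding frechet_derivative_works by (rule has_derivative_compose)
  then have "(K has_derivative (\<lambda>x. frechet_derivative G (at (F z)) (frechet_derivative F (at z) x))) (at z)"
    by (rule has_derivative_transform_within_open[OF _ U])
  from frechet_derivative_at[OF this] show ?thesis by metis
qed

lemma mv_holomorphic_on_differentiable: "mv_holomorphic_on F S \<Longrightarrow> z \<in> S \<Longrightarrow> F differentiable (at z)"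
  using mv_holomorphic_on_has_derivative differentiableI by blast

abbreviation transition_derivative ::
  "('a, 'n::finite) chart \<Rightarrow> ('a, 'n) chart \<Rightarrow> 'a \<Rightarrow> complex^'n \<Rightarrow> complex^'n" where
  "transition_derivative c d q \<equiv> frechet_derivative (transition c d) (at (chart_map c q))"

text \<open>Builds the whole family of components from the single component \<open>x\<close> in the
  chart \<open>c\<close>, so that coordinate vectors can be fed to notions defined on tangent
  vectors.\<close>

definition tvec_of :: "('a, 'n::finite) chart set \<Rightarrow> ('a, 'n) chart \<Rightarrow> 'a \<Rightarrow> complex^'n \<Rightarrow> ('a, 'n) tvec" where
  "tvec_of \<A> c q x = (\<lambda>d. if d \<in> \<A> \<and> q \<in> chart_dom d then transition_derivative c d q x else 0)"

lemma coord_vec_eq_tvec_of: "coord_vec \<A> c q k = tvec_of \<A> c q (axis k 1)"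
  by (simp add: coord_vec_def tvec_of_def)

context
  fixes X :: "'a topology" and \<A> :: "('a, 'n::finite) chart set"
  assumes X: "complex_manifold X \<A>"
begin

lemma manifold_chart: "c \<in> \<A> \<Longrightarrow> is_chart X c"
  using X unfolding complex_manifold_def by blast

lemma manifold_openin: "c \<in> \<A> \<Longrightarrow> openin X (chart_dom c)"
  using manifold_chart unfolding is_chart_def by blast

lemma manifold_topspace: "c \<in> \<A> \<Longrightarrow> q \<in> chart_dom c \<Longrightarrow> q \<in> topspace X"
  using manifold_openin openin_subset by blast

lemma manifold_chart_exists: "q \<in> topspace X \<Longrightarrow> \<exists>c\<in>\<A>. q \<in> chart_dom c"
  using X unfolding complex_manifold_def by blast

lemma transition_holomorphic:
  assumes "c \<in> \<A>" "d \<in> \<A>"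
  shows "mv_holomorphic_on (transition c d) (chart_map c ` (chart_dom c \<inter> chart_dom d))"
  using X assms unfolding complex_manifold_def by blast

lemma transition_chart_map:
  assumes "c \<in> \<A>" "q \<in> chart_dom c"
  shows "transition c d (chart_map c q) = chart_map d q"
  using is_chart_inverse(1)[OF manifold_chart[OF assms(1)] assms(2)] by (simp add: transition_def)

text \<open>Cocycle rule, from the chain rule on the overlap; it makes \<open>tvec_of\<close> a
  tangent vector.\<close>

lemma transition_derivative_trans:
  assumes "c \<in> \<A>" "d \<in> \<A>" "e \<in> \<A>" "q \<in> chart_dom c" "q \<in> chart_dom d" "q \<in> chart_dom e"
  shows "transition_derivative d e q (transition_derivative c d q x) = transition_derivative c e q x"
proof -
  have "transition_derivative c e q x
      = frechet_derivative (transition d e) (at (transition c d (chart_map c q))) (transition_derivative c d q x)"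
  proof (rule frechet_derivative_chain)
    show "transition c d differentiable at (chart_map c q)"
      by (rule mv_holomorphic_on_differentiable[OF transition_holomorphic]) (use assms in auto)
    show "transition d e differentiable at (transition c d (chart_map c q))"
      unfolding transition_chart_map[OF assms(1,4)]
      by (rule mv_holomorphic_on_differentiable[OF transition_holomorphic]) (use assms in auto)
    show "open (chart_map c ` (chart_dom c \<inter> chart_dom d))"
      by (intro is_chart_open_image[OF manifold_chart[OF assms(1)]] openin_Int manifold_openin assms) auto
    show "transition d e (transition c d y) = transition c e y" if "y \<in> chart_map c ` (chart_dom c \<inter> chart_dom d)" for y
      using that assms by (auto simp: transition_chart_map)
  qed (use assms in auto)
  then show ?thesis by (simp add: transition_chart_map[OF assms(1,4)])
qed

lemma transition_derivative_self:
  assumes "c \<in> \<A>" "q \<in> chart_dom c"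
  shows "transition_derivative c c q x = x"
proof -
  have c: "open (chart_ran c)" using manifold_chart[OF assms(1)] unfolding is_chart_def by blast
  have "transition_derivative c c q = frechet_derivative (\<lambda>x. x) (at (chart_map c q))"
    by (rule frechet_derivative_cong_open[OF c]) (use assms in \<open>auto simp: transition_chart_map\<close>)
  then show ?thesis by simp
qed

lemma transition_derivative_affine:
  assumes "c \<in> \<A>" "d \<in> \<A>" "q \<in> chart_dom c" "q \<in> chart_dom d"
  shows "transition_derivative c d q (a *s x + y) = a *s transition_derivative c d q x + transition_derivative c d q y"
proof -
  have "chart_map c q \<in> chart_map c ` (chart_dom c \<inter> chart_dom d)" using assms by blast
  note * = transition_holomorphic[OF assms(1,2)] this
  show ?thesis
    unfolding mv_holomorphic_on_derivative_add[OF *] mv_holomorphic_on_derivative_smult[OF *] ..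
qed

lemma tvec_of_in_tangent_space:
  assumes "c \<in> \<A>" "q \<in> chart_dom c"
  shows "tvec_of \<A> c q x \<in> hol_tangent_space \<A> q"
  using assms by (auto simp: hol_tangent_space_def tvec_of_def transition_derivative_trans)

lemma tvec_of_component: "c \<in> \<A> \<Longrightarrow> q \<in> chart_dom c \<Longrightarrow> tvec_of \<A> c q x c = x"
  by (simp add: tvec_of_def transition_derivative_self)

lemma tvec_of_transition:
  assumes "c \<in> \<A>" "d \<in> \<A>" "q \<in> chart_dom c" "q \<in> chart_dom d"
  shows "tvec_of \<A> d q (transition_derivative c d q x) = tvec_of \<A> c q x"
  using assms by (auto simp: tvec_of_def transition_derivative_trans)

lemma tvec_of_affine:
  assumes "c \<in> \<A>" "q \<in> chart_dom c"
  shows "tvec_of \<A> c q (a *s x + y) = (\<lambda>d. a *s tvec_of \<A> c q x d + tvec_of \<A> c q y d)"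
  using assms by (auto simp: tvec_of_def transition_derivative_affine)

lemma tvec_of_eq_zero_iff:
  assumes "c \<in> \<A>" "q \<in> chart_dom c"
  shows "tvec_of \<A> c q x = (\<lambda>d. 0) \<longleftrightarrow> x = 0"
proof
  assume "x = 0"
  \<comment> \<open>Linearity is at hand in the form of \<open>tvec_of_affine\<close>, so the zero
    vector is written as an affine combination whose image cancels.\<close>
  then have "(- 1) *s x + x = x" by simp
  from this[symmetric] have "tvec_of \<A> c q x = tvec_of \<A> c q ((- 1) *s x + x)" by (rule arg_cong)
  also have "\<dots> = (\<lambda>d. (- 1) *s tvec_of \<A> c q x d + tvec_of \<A> c q x d)"
    by (rule tvec_of_affine[OF assms])
  also have "\<dots> = (\<lambda>d. 0)"
    by (simp add: vec_eq_iff fun_eq_iff)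
  finally show "tvec_of \<A> c q x = (\<lambda>d. 0)" .
next
  assume "tvec_of \<A> c q x = (\<lambda>d. 0)"
  from fun_cong[OF this, of c] show "x = 0"
    unfolding tvec_of_component[OF assms] .
qed

end

section \<open>Metrics in coordinates\<close>

lemma affine_imp_sum_axis:
  fixes \<phi> :: "complex^'n \<Rightarrow> complex"
  assumes "\<And>a x y. \<phi> (a *s x + y) = a * \<phi> x + \<phi> y"
  shows "\<phi> x = (\<Sum>k\<in>UNIV. x $ k * \<phi> (axis k 1))"
proof -
  have "\<phi> 0 = 1 * \<phi> 0 + \<phi> 0" using assms[of 1 0 0] by (simp only: vector_smult_rzero add_0_left)
  then have 0: "\<phi> 0 = 0" by (simp only: mult_1 add_cancel_right_right) 
  have "\<phi> (\<Sum>k\<in>I. x $ k *s axis k 1) = (\<Sum>k\<in>I. x $ k * \<phi> (axis k 1))" if "finite I" for I :: "'n set"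
    using that
  proof (induction I rule: finite_induct)
    case empty
    show ?case by (simp only: sum.empty 0)
  next
    case (insert k I)
    show ?case unfolding sum.insert[OF insert(1,2)] assms insert.IH ..
  qed
  from this[OF finite[of UNIV]] show ?thesis by (simp only: basis_expansion)
qed

text \<open>Linearity in the first slot is part of \<open>hermitian_metric\<close>; conjugate
  linearity in the second slot follows from it by Hermitian symmetry. Expanding both slots in
  coordinate vectors gives the matrix form.\<close>

lemma metric_eq_hform:
  fixes g :: "('a, 'n::finite) metric"
  assumes X: "complex_manifold X \<A>" and g: "hermitian_metric X \<A> g" and c: "c \<in> \<A>" "q \<in> chart_dom c"
  shows "g q (tvec_of \<A> c q x) (tvec_of \<A> c q y) = hform (metric_matrix \<A> g c (chart_map c q)) x y"
proof -
  note q = manifold_topspace[OF X c]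
  note T = tvec_of_in_tangent_space[OF X c]
  have g_lin: "g q (\<lambda>c. a *s u c + v c) w = a * g q u w + g q v w"
    if "u \<in> hol_tangent_space \<A> q" "v \<in> hol_tangent_space \<A> q" "w \<in> hol_tangent_space \<A> q" for a u v w
    using g q that unfolding hermitian_metric_def by blast
  have lin: "g q (tvec_of \<A> c q x) w = (\<Sum>k\<in>UNIV. x $ k * g q (coord_vec \<A> c q k) w)"
    if w: "w \<in> hol_tangent_space \<A> q" for x w
    unfolding coord_vec_eq_tvec_of
  proof (rule affine_imp_sum_axis[where \<phi>="\<lambda>x. g q (tvec_of \<A> c q x) w"])
    fix a x y
    show "g q (tvec_of \<A> c q (a *s x + y)) w = a * g q (tvec_of \<A> c q x) w + g q (tvec_of \<A> c q y) w"
      unfolding tvec_of_affine[OF X c] by (rule g_lin[OF T T w])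
  qed
  have sym: "g q v u = cnj (g q u v)" if "u \<in> hol_tangent_space \<A> q" "v \<in> hol_tangent_space \<A> q" for u v
    using g q that unfolding hermitian_metric_def by blast
  have Tc: "coord_vec \<A> c q k \<in> hol_tangent_space \<A> q" for k
    unfolding coord_vec_eq_tvec_of by (rule T)
  have "g q (coord_vec \<A> c q k) (tvec_of \<A> c q y) = (\<Sum>l\<in>UNIV. cnj (y $ l) * g q (coord_vec \<A> c q k) (coord_vec \<A> c q l))" for k
    unfolding sym[OF T Tc] lin[OF Tc] by (simp add: sym[OF Tc Tc, symmetric])
  then have "g q (tvec_of \<A> c q x) (tvec_of \<A> c q y)
      = (\<Sum>k\<in>UNIV. x $ k * (\<Sum>l\<in>UNIV. cnj (y $ l) * g q (coord_vec \<A> c q k) (coord_vec \<A> c q l)))"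
    unfolding lin[OF T] by simp
  also have "\<dots> = hform (metric_matrix \<A> g c (chart_map c q)) x y"
    by (simp add: hform_def metric_matrix_def Let_def is_chart_inverse(1)[OF manifold_chart[OF X c(1)] c(2)]
        sum_distrib_left ac_simps)
  finally show ?thesis .
qed

text \<open>Gives access to the coordinate results. Positivity carries over because
  \<open>tvec_of\<close> sends nonzero coordinate vectors to nonzero tangent vectors.\<close>

lemma local_metric_metric_matrix:
  assumes X: "complex_manifold X \<A>" and g: "hermitian_metric X \<A> g" and c: "c \<in> \<A>"
  shows "local_metric (metric_matrix \<A> g c) (chart_ran c)"
  unfolding local_metric_def
proof (intro conjI ballI allI impI)
  show "open (chart_ran c)" using manifold_chart[OF X c] unfolding is_chart_def by blast
  show "Ck_on 2 (\<lambda>z. metric_matrix \<A> g c z $ k $ l) (chart_ran c)" for k l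
    using g c unfolding hermitian_metric_def smooth_on_def by blast
next
  fix z assume "z \<in> chart_ran c"
  then obtain q where q: "q \<in> chart_dom c" "z = chart_map c q" by blast
  note T = tvec_of_in_tangent_space[OF X c q(1)]
  note qX = manifold_topspace[OF X c q(1)]
  have sym: "g q v u = cnj (g q u v)" if "u \<in> hol_tangent_space \<A> q" "v \<in> hol_tangent_space \<A> q" for u v
    using g qX that unfolding hermitian_metric_def by blast
  show "metric_matrix \<A> g c z $ l $ k = cnj (metric_matrix \<A> g c z $ k $ l)" for k l
    using sym[OF T T, of "axis l 1" "axis k 1"]
    by (simp add: metric_matrix_def Let_def q(2) is_chart_inverse(1)[OF manifold_chart[OF X c] q(1)] coord_vec_eq_tvec_of)
  show "Re (hform (metric_matrix \<A> g c z) x x) > 0" if "x \<noteq> 0" for x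
  proof -
    have "Re (g q u u) > 0" if "u \<in> hol_tangent_space \<A> q" "u \<noteq> (\<lambda>d. 0)" for u
      using g qX that unfolding hermitian_metric_def by blast
    from this[OF T] have "Re (g q (tvec_of \<A> c q x) (tvec_of \<A> c q x)) > 0"
      using that tvec_of_eq_zero_iff[OF X c q(1), of x] by blast
    then show ?thesis by (simp only: metric_eq_hform[OF X g c q(1)] q(2))
  qed
qed

lemma chern_curvature_eq_chern_form:
  "chern_curvature \<A> g c q u v = chern_form (metric_matrix \<A> g c) (chart_map c q) (u c) (v c)"
  by (simp add: chern_curvature_def chern_form_def)

lemma Ck_on_subset: "Ck_on k F S \<Longrightarrow> T \<subseteq> S \<Longrightarrow> Ck_on k F T"
  by (induction k arbitrary: F) (auto intro: continuous_on_subset)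

lemma local_metric_subset:
  assumes "local_metric G S" "T \<subseteq> S" "open T"
  shows "local_metric G T"
  using assms Ck_on_subset unfolding local_metric_def by blast

lemma continuous_on_hform:
  assumes "\<And>k l. continuous_on K (\<lambda>p. A p $ k $ l)" "continuous_on K x" "continuous_on K y"
  shows "continuous_on K (\<lambda>p. hform (A p) (x p) (y p))"
  unfolding hform_def by (intro continuous_intros assms continuous_on_component)

lemma local_metric_continuous:
  assumes "local_metric G S"
  shows "continuous_on S (\<lambda>z. G z $ k $ l)"
  using local_metricD(2)[OF assms, of k l] Ck_on_Suc_continuous[of 1] by (metis Suc_1)

text \<open>Complex linearity in \<open>x\<close> reduces the claim to continuity in
  \<open>z\<close> for the finitely many directions \<open>axis k 1\<close>.\<close>

lemma mv_holomorphic_on_derivative_jointly_continuous: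
  fixes F :: "complex^'m \<Rightarrow> complex^'n"
  assumes F: "mv_holomorphic_on F S" and S: "open S"
  shows "continuous_on (S \<times> UNIV) (\<lambda>(z, x). frechet_derivative F (at z) x)"
proof -
  have "frechet_derivative F (at z) x = (\<Sum>k\<in>UNIV. x $ k *s frechet_derivative F (at z) (axis k 1))" if "z \<in> S" for z x
  proof -
    have zero: "frechet_derivative F (at z) 0 = 0"
      using mv_holomorphic_on_derivative_smult[OF F that, of 0 0] by (simp only: vector_smult_lzero)
    have "frechet_derivative F (at z) (\<Sum>k\<in>I. x $ k *s axis k 1)
        = (\<Sum>k\<in>I. x $ k *s frechet_derivative F (at z) (axis k 1))" for I :: "'m set"
      by (induction I rule: infinite_finite_induct)
         (simp_all add: zero mv_holomorphic_on_derivative_smult[OF F that] mv_holomorphic_on_derivative_add[OF F that])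
    from this[of UNIV] show ?thesis by (simp only: basis_expansion)
  qed
  moreover have "continuous_on (S \<times> UNIV) (\<lambda>p. \<Sum>k\<in>UNIV. snd p $ k *s frechet_derivative F (at (fst p)) (axis k 1))"
    unfolding continuous_on_vec_componentwise
  proof
    fix i
    have "continuous_on (S \<times> UNIV) (\<lambda>p::(complex^'m) \<times> (complex^'m). frechet_derivative F (at (fst p)) (axis k 1) $ i)" for k
      by (intro continuous_on_component
          continuous_on_compose2[OF mv_holomorphic_on_derivative_continuous[OF F S]] continuous_intros) auto
    then show "continuous_on (S \<times> UNIV) (\<lambda>p. (\<Sum>k\<in>UNIV. snd p $ k *s frechet_derivative F (at (fst p)) (axis k 1)) $ i)"
      unfolding sum_component vector_smult_component
      by (intro continuous_on_sum continuous_on_mult continuous_on_component[OF continuous_on_snd[OF continuous_on_id]]) blast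
  qed
  ultimately show ?thesis
    by (subst continuous_on_cong[OF refl, where g="\<lambda>p. \<Sum>k\<in>UNIV. snd p $ k *s frechet_derivative F (at (fst p)) (axis k 1)"]) auto
qed


section \<open>The maximum of the ratio of the two metrics\<close>

locale holomorphic_map_between =
  fixes M :: "'a topology" and \<A> :: "('a, 'm::finite) chart set"
    and N :: "'b topology" and \<B> :: "('b, 'n::finite) chart set" and f :: "'a \<Rightarrow> 'b"
  assumes M: "complex_manifold M \<A>" and N: "complex_manifold N \<B>" and f: "holomorphic_map M \<A> N \<B> f"
begin

abbreviation local_rep :: "('a, 'm) chart \<Rightarrow> ('b, 'n) chart \<Rightarrow> complex^'m \<Rightarrow> complex^'n" where
  "local_rep c d \<equiv> chart_map d \<circ> f \<circ> chart_inv c"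

abbreviation local_dom :: "('a, 'm) chart \<Rightarrow> ('b, 'n) chart \<Rightarrow> (complex^'m) set" where
  "local_dom c d \<equiv> chart_map c ` {p \<in> chart_dom c. f p \<in> chart_dom d}"

abbreviation local_derivative :: "('a, 'm) chart \<Rightarrow> ('b, 'n) chart \<Rightarrow> 'a \<Rightarrow> complex^'m \<Rightarrow> complex^'n" where
  "local_derivative c d q \<equiv> frechet_derivative (local_rep c d) (at (chart_map c q))"

lemma local_rep_holomorphic: "c \<in> \<A> \<Longrightarrow> d \<in> \<B> \<Longrightarrow> mv_holomorphic_on (local_rep c d) (local_dom c d)"
  using f unfolding holomorphic_map_def by blast

lemma local_rep_chart_map:
  "c \<in> \<A> \<Longrightarrow> q \<in> chart_dom c \<Longrightarrow> local_rep c d (chart_map c q) = chart_map d (f q)"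
  using is_chart_inverse(1)[OF manifold_chart[OF M]] by simp

lemma local_dom_preimage_open:
  assumes "c \<in> \<A>" "d \<in> \<B>"
  shows "openin M {p \<in> chart_dom c. f p \<in> chart_dom d}"
proof -
  have "openin M {p \<in> topspace M. f p \<in> chart_dom d}"
    using f manifold_openin[OF N assms(2)] openin_continuous_map_preimage
    unfolding holomorphic_map_def by blast
  then have "openin M (chart_dom c \<inter> {p \<in> topspace M. f p \<in> chart_dom d})"
    by (intro openin_Int manifold_openin[OF M assms(1)])
  moreover have "chart_dom c \<inter> {p \<in> topspace M. f p \<in> chart_dom d} = {p \<in> chart_dom c. f p \<in> chart_dom d}"
    using manifold_topspace[OF M assms(1)] by blast
  ultimately show ?thesis by simp
qed

lemma local_dom_open:
  assumes "c \<in> \<A>" "d \<in> \<B>"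
  shows "open (local_dom c d)"
  by (rule is_chart_open_image[OF manifold_chart[OF M assms(1)] local_dom_preimage_open[OF assms]]) blast

lemma mem_local_dom:
  assumes "c \<in> \<A>" "p \<in> chart_dom c" "chart_map c p \<in> local_dom c d"
  shows "f p \<in> chart_dom d"
proof -
  obtain p' where p': "p' \<in> chart_dom c" "f p' \<in> chart_dom d" "chart_map c p = chart_map c p'"
    using assms(3) by blast
  have "p = p'"
    by (rule inj_onD[OF is_chart_inverse(4)[OF manifold_chart[OF M assms(1)]] p'(3) assms(2) p'(1)])
  then show ?thesis using p'(2) by (rule ssubst)
qed

lemma charts_exist:
  assumes "q \<in> topspace M"
  obtains c d where "c \<in> \<A>" "d \<in> \<B>" "q \<in> chart_dom c" "f q \<in> chart_dom d"
proof -
  have "f q \<in> topspace N"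
    using f assms unfolding holomorphic_map_def continuous_map_def by blast
  then obtain d where "d \<in> \<B>" "f q \<in> chart_dom d"
    using manifold_chart_exists[OF N] by blast
  moreover obtain c where "c \<in> \<A>" "q \<in> chart_dom c"
    using manifold_chart_exists[OF M assms] by blast
  ultimately show ?thesis using that by blast
qed

lemma local_derivative_transition_target:
  assumes "c \<in> \<A>" "d \<in> \<B>" "d' \<in> \<B>" "q \<in> chart_dom c" "f q \<in> chart_dom d" "f q \<in> chart_dom d'"
  shows "local_derivative c d' q x = transition_derivative d d' (f q) (local_derivative c d q x)"
proof -
  have "local_derivative c d' q x
      = frechet_derivative (transition d d') (at (local_rep c d (chart_map c q))) (local_derivative c d q x)"
  proof (rule frechet_derivative_chain)
    show "local_rep c d differentiable at (chart_map c q)"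
      by (rule mv_holomorphic_on_differentiable[OF local_rep_holomorphic]) (use assms in auto)
    show "transition d d' differentiable at (local_rep c d (chart_map c q))"
      unfolding local_rep_chart_map[OF assms(1,4)]
      by (rule mv_holomorphic_on_differentiable[OF transition_holomorphic[OF N]]) (use assms in auto)
    show "open (local_dom c d)" by (rule local_dom_open[OF assms(1,2)])
    show "transition d d' (local_rep c d y) = local_rep c d' y" if y: "y \<in> local_dom c d" for y
    proof -
      obtain p where p: "p \<in> chart_dom c" "f p \<in> chart_dom d" "y = chart_map c p" using y by blast
      show ?thesis
        unfolding p(3) local_rep_chart_map[OF assms(1) p(1)] by (rule transition_chart_map[OF N assms(2) p(2)])
    qed
  qed (use assms in blast)
  then show ?thesis unfolding local_rep_chart_map[OF assms(1,4)] .
qed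

lemma local_derivative_transition_source:
  assumes "c \<in> \<A>" "c' \<in> \<A>" "d \<in> \<B>" "q \<in> chart_dom c" "q \<in> chart_dom c'" "f q \<in> chart_dom d"
  shows "local_derivative c d q x = local_derivative c' d q (transition_derivative c c' q x)"
proof -
  let ?U = "chart_map c ` (chart_dom c \<inter> chart_dom c')"
  have "local_derivative c d q x
      = frechet_derivative (local_rep c' d) (at (transition c c' (chart_map c q))) (transition_derivative c c' q x)"
  proof (rule frechet_derivative_chain)
    show "transition c c' differentiable at (chart_map c q)"
      by (rule mv_holomorphic_on_differentiable[OF transition_holomorphic[OF M]]) (use assms in auto)
    show "local_rep c' d differentiable at (transition c c' (chart_map c q))"
      unfolding transition_chart_map[OF M assms(1,4)]
      by (rule mv_holomorphic_on_differentiable[OF local_rep_holomorphic]) (use assms in auto)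
    show "open ?U"
      by (intro is_chart_open_image[OF manifold_chart[OF M assms(1)]] openin_Int manifold_openin[OF M] assms) blast
    show "local_rep c' d (transition c c' y) = local_rep c d y" if y: "y \<in> ?U" for y
    proof -
      obtain p where p: "p \<in> chart_dom c" "p \<in> chart_dom c'" "y = chart_map c p" using y by blast
      show ?thesis
        unfolding p(3) transition_chart_map[OF M assms(1) p(1)] local_rep_chart_map[OF assms(1) p(1)]
          local_rep_chart_map[OF assms(2) p(2)] ..
    qed
  qed (use assms in blast)
  then show ?thesis unfolding transition_chart_map[OF M assms(1,4)] .
qed

text \<open>On a coordinate ball, which is convex, a vanishing derivative makes the local
  representation constant, so \<open>f\<close> is locally constant; connectedness of
  \<open>M\<close> does the rest.\<close>

lemma constant_if_derivative_zero:
  assumes zero: "\<And>c d q x. c \<in> \<A> \<Longrightarrow> d \<in> \<B> \<Longrightarrow> q \<in> chart_dom c \<Longrightarrow> f q \<in> chart_dom d \<Longrightarrow> local_derivative c d q x = 0"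
  shows "f constant_on topspace M"
proof -
  have loc: "\<exists>U. openin M U \<and> p \<in> U \<and> (\<forall>q\<in>U. f q = f p)" if p: "p \<in> topspace M" for p
  proof -
    obtain c d where cd: "c \<in> \<A>" "d \<in> \<B>" "p \<in> chart_dom c" "f p \<in> chart_dom d"
      using charts_exist[OF p] .
    have "chart_map c p \<in> local_dom c d" using cd by blast
    then obtain r where r: "r > 0" "ball (chart_map c p) r \<subseteq> local_dom c d"
      using local_dom_open[OF cd(1,2)] open_contains_ball by blast
    let ?B = "ball (chart_map c p) r"
    let ?U = "{q \<in> chart_dom c. chart_map c q \<in> ?B}"
    have "\<exists>k. \<forall>z\<in>?B. local_rep c d z = k"
    proof (rule has_derivative_zero_constant)
      fix z assume "z \<in> ?B"
      then obtain q where q: "q \<in> chart_dom c" "f q \<in> chart_dom d" "z = chart_map c q"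
        using r(2) by blast
      have "frechet_derivative (local_rep c d) (at z) = (\<lambda>h. 0)"
        unfolding q(3) by (rule ext) (rule zero[OF cd(1,2) q(1,2)])
      moreover have "(local_rep c d has_derivative frechet_derivative (local_rep c d) (at z)) (at z)"
        by (rule mv_holomorphic_on_has_derivative[OF local_rep_holomorphic[OF cd(1,2)]]) (use q in blast)
      ultimately have "(local_rep c d has_derivative (\<lambda>h. 0)) (at z)" by (simp only:)
      then show "(local_rep c d has_derivative (\<lambda>h. 0)) (at z within ?B)"
        by (rule has_derivative_at_withinI)
    qed simp
    then obtain k where k: "\<And>z. z \<in> ?B \<Longrightarrow> local_rep c d z = k" by blast
    have "f q = f p" if "q \<in> ?U" for q
    proof -
      have q: "q \<in> chart_dom c" "chart_map c q \<in> ?B" using that by blast+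
      have "chart_map d (f q) = chart_map d (f p)"
        unfolding local_rep_chart_map[OF cd(1) q(1), of d, symmetric] local_rep_chart_map[OF cd(1,3), of d, symmetric]
        using k[OF q(2)] k[of "chart_map c p"] r(1) by (simp only: centre_in_ball)
      \<comment> \<open>Equal coordinates identify two points of \<open>N\<close> only if both lie
        in the domain of the chart.\<close>
      moreover have "f q \<in> chart_dom d"
        using mem_local_dom[OF cd(1) q(1)] q(2) r(2) by blast
      ultimately show ?thesis
        using cd(4) by (rule inj_onD[OF is_chart_inverse(4)[OF manifold_chart[OF N cd(2)]]])
    qed
    moreover have "openin M ?U" by (rule is_chart_open_preimage[OF manifold_chart[OF M cd(1)] open_ball])
    moreover have "p \<in> ?U" using cd r by simp
    ultimately show ?thesis by (intro exI[of _ ?U]) blast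
  qed
  have "f q = f p" if p: "p \<in> topspace M" and q: "q \<in> topspace M" for p q
  proof (rule ccontr)
    assume ne: "f q \<noteq> f p"
    let ?E = "{x \<in> topspace M. f x = f p}" and ?F = "{x \<in> topspace M. f x \<noteq> f p}"
    \<comment> \<open>For locally constant \<open>f\<close> every condition on the value
      \<open>f x\<close> defines an open set; a level set and its complement are both of this
      kind.\<close>
    have "openin M {x \<in> topspace M. Q (f x)}" for Q
      unfolding openin_subopen[of M "{x \<in> topspace M. Q (f x)}"]
    proof
      fix x assume x: "x \<in> {x \<in> topspace M. Q (f x)}"
      then have "x \<in> topspace M" by simp
      from loc[OF this] obtain U where U: "openin M U" "x \<in> U" "\<forall>y\<in>U. f y = f x"
        by (elim exE conjE)
      have "U \<subseteq> {x \<in> topspace M. Q (f x)}"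
      proof
        fix y assume y: "y \<in> U"
        then show "y \<in> {x \<in> topspace M. Q (f x)}"
          using x bspec[OF U(3) y] openin_subset[OF U(1)] by auto
      qed
      with U(1,2) show "\<exists>T. openin M T \<and> x \<in> T \<and> T \<subseteq> {x \<in> topspace M. Q (f x)}" by blast
    qed
    from this[of "\<lambda>y. y = f p"] this[of "\<lambda>y. y \<noteq> f p"]
    have "openin M ?E" "openin M ?F" .
    moreover have "connected_space M" using M unfolding complex_manifold_def by blast
    moreover have "?E \<inter> ?F = {}" "topspace M \<subseteq> ?E \<union> ?F" "?E \<noteq> {}" "?F \<noteq> {}" using p q ne by blast+
    ultimately show False unfolding connected_space_def by meson
  qed
  then show ?thesis unfolding constant_on_def by blast
qed

end

section \<open>The pulled-back norm compared with the norm of \<open>M\<close>\<close>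

locale holomorphic_map_metrics = holomorphic_map_between M \<A> N \<B> f
  for M :: "'a topology" and \<A> :: "('a, 'm::finite) chart set"
    and N :: "'b topology" and \<B> :: "('b, 'n::finite) chart set" and f :: "'a \<Rightarrow> 'b" +
  fixes g :: "('a, 'm) metric" and h :: "('b, 'n) metric"
  assumes g: "hermitian_metric M \<A> g" and h: "hermitian_metric N \<B> h"
begin

text \<open>Both norms are squared lengths, hence the factor \<open>(norm a)^2\<close> under
  scaling. They take the point \<open>z\<close> and the vector \<open>x\<close> as separate
  coordinate arguments, so that continuity in the pair makes sense.\<close>

definition source_norm :: "('a, 'm) chart \<Rightarrow> complex^'m \<Rightarrow> complex^'m \<Rightarrow> real" where
  "source_norm c z x = Re (hform (metric_matrix \<A> g c z) x x)"

definition target_norm :: "('a, 'm) chart \<Rightarrow> ('b, 'n) chart \<Rightarrow> complex^'m \<Rightarrow> complex^'m \<Rightarrow> real" where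
  "target_norm c d z x = Re (hform (metric_matrix \<B> h d (local_rep c d z))
     (frechet_derivative (local_rep c d) (at z) x) (frechet_derivative (local_rep c d) (at z) x))"

lemma source_norm_transition:
  assumes "c \<in> \<A>" "c' \<in> \<A>" "q \<in> chart_dom c" "q \<in> chart_dom c'"
  shows "source_norm c' (chart_map c' q) (transition_derivative c c' q x) = source_norm c (chart_map c q) x"
  unfolding source_norm_def metric_eq_hform[OF M g assms(1,3), symmetric] metric_eq_hform[OF M g assms(2,4), symmetric]
    tvec_of_transition[OF M assms] ..

text \<open>Both sides equal the squared length in \<open>h\<close> at \<open>f q\<close> of the
  same pushed-forward vector; the chain rule on the source and on the target removes the
  charts.\<close>

lemma target_norm_transition:
  assumes "c \<in> \<A>" "c' \<in> \<A>" "d \<in> \<B>" "d' \<in> \<B>" "q \<in> chart_dom c" "q \<in> chart_dom c'" "f q \<in> chart_dom d" "f q \<in> chart_dom d'"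
  shows "target_norm c' d' (chart_map c' q) (transition_derivative c c' q x) = target_norm c d (chart_map c q) x"
  unfolding target_norm_def local_rep_chart_map[OF assms(1,5)] local_rep_chart_map[OF assms(2,6)]
    local_derivative_transition_source[OF assms(1,2,4,5,6,8), symmetric]
    local_derivative_transition_target[OF assms(1,3,4,5,7,8)]
    metric_eq_hform[OF N h assms(3,7), symmetric] metric_eq_hform[OF N h assms(4,8), symmetric]
    tvec_of_transition[OF N assms(3,4,7,8)] ..

lemma source_norm_pos:
  assumes "c \<in> \<A>" "z \<in> chart_ran c" "x \<noteq> 0"
  shows "source_norm c z x > 0"
  unfolding source_norm_def using local_metricD(4)[OF local_metric_metric_matrix[OF M g assms(1)] assms(2,3)] .

lemma source_norm_smult: "source_norm c z (a *s x) = (norm a)^2 * source_norm c z x"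
  unfolding source_norm_def hform_smult
  by (simp add: complex_mult_cnj cmod_power2 flip: of_real_power of_real_add)

lemma target_norm_smult:
  assumes "c \<in> \<A>" "d \<in> \<B>" "z \<in> local_dom c d"
  shows "target_norm c d z (a *s x) = (norm a)^2 * target_norm c d z x"
  unfolding target_norm_def mv_holomorphic_on_derivative_smult[OF local_rep_holomorphic[OF assms(1,2)] assms(3)] hform_smult
  by (simp add: complex_mult_cnj cmod_power2 flip: of_real_power of_real_add)

lemma continuous_on_source_norm:
  assumes "c \<in> \<A>" "K \<subseteq> chart_ran c"
  shows "continuous_on (K \<times> UNIV) (\<lambda>p. source_norm c (fst p) (snd p))"
  unfolding source_norm_def
  by (intro continuous_on_Re continuous_on_hform continuous_on_snd continuous_on_id
      continuous_on_compose2[OF local_metric_continuous[OF local_metric_metric_matrix[OF M g assms(1)]]]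
      continuous_on_fst) (use assms(2) in auto)

lemma continuous_on_target_norm:
  assumes "c \<in> \<A>" "d \<in> \<B>"
  shows "continuous_on (local_dom c d \<times> UNIV) (\<lambda>p. target_norm c d (fst p) (snd p))"
proof -
  note F = local_rep_holomorphic[OF assms]
  have D: "continuous_on (local_dom c d \<times> UNIV) (\<lambda>p. frechet_derivative (local_rep c d) (at (fst p)) (snd p))"
    using mv_holomorphic_on_derivative_jointly_continuous[OF F local_dom_open[OF assms]] by (simp add: case_prod_beta)
  have "continuous_on (local_dom c d \<times> (UNIV :: (complex^'m) set)) (\<lambda>p. local_rep c d (fst p))"
    by (rule continuous_on_compose2[OF mv_holomorphic_on_imp_continuous_on[OF F] continuous_on_fst[OF continuous_on_id]]) auto
  moreover have "local_rep c d z \<in> chart_ran d" if z: "z \<in> local_dom c d" for z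
  proof -
    obtain q where q: "q \<in> chart_dom c" "f q \<in> chart_dom d" "z = chart_map c q" using z by blast
    show ?thesis unfolding q(3) local_rep_chart_map[OF assms(1) q(1)] using q(2) by blast
  qed
  ultimately have "continuous_on (local_dom c d \<times> (UNIV :: (complex^'m) set)) (\<lambda>p. metric_matrix \<B> h d (local_rep c d (fst p)) $ k $ l)" for k l
    by (intro continuous_on_compose2[OF local_metric_continuous[OF local_metric_metric_matrix[OF N h assms(2)]]]) auto
  then show ?thesis
    unfolding target_norm_def by (intro continuous_on_Re continuous_on_hform D)
qed

text \<open>On a closed coordinate ball times the Euclidean unit sphere the ratio is a continuous
  function on a compact set. Finitely many such balls cover \<open>M\<close>, and the largest of
  their maxima bounds the ratio everywhere by chart independence and homogeneity.\<close>

lemma target_norm_le_maximum: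
  assumes ne: "topspace M \<noteq> {}" and comp: "compact_space M"
  obtains m c d q x where "c \<in> \<A>" "d \<in> \<B>" "q \<in> chart_dom c" "f q \<in> chart_dom d" "x \<noteq> 0"
    "target_norm c d (chart_map c q) x = m * source_norm c (chart_map c q) x"
    "\<And>c d q x. c \<in> \<A> \<Longrightarrow> d \<in> \<B> \<Longrightarrow> q \<in> chart_dom c \<Longrightarrow> f q \<in> chart_dom d \<Longrightarrow>
       target_norm c d (chart_map c q) x \<le> m * source_norm c (chart_map c q) x"
proof -
  define S where "S = sphere (0::complex^'m) 1"
  have S: "compact S" "S \<noteq> {}" unfolding S_def by simp_all
  define Q where "Q = (\<lambda>p (c, d, r). c \<in> \<A> \<and> d \<in> \<B> \<and> p \<in> chart_dom c \<and> r > 0 \<and>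
    cball (chart_map c p) r \<subseteq> local_dom c d)"
  have "\<exists>t. Q p t" if p: "p \<in> topspace M" for p
  proof -
    obtain c d where cd: "c \<in> \<A>" "d \<in> \<B>" "p \<in> chart_dom c" "f p \<in> chart_dom d"
      using charts_exist[OF p] .
    then have "chart_map c p \<in> local_dom c d" by blast
    then obtain r where "r > 0" "cball (chart_map c p) r \<subseteq> local_dom c d"
      using local_dom_open[OF cd(1,2)] open_contains_cball by blast
    then have "Q p (c, d, r)" using cd unfolding Q_def by blast
    then show ?thesis by (rule exI)
  qed
  then obtain t where t: "\<And>p. p \<in> topspace M \<Longrightarrow> Q p (t p)"
    using bchoice[of "topspace M" Q] by blast
  define C where "C = (\<lambda>p. fst (t p))"
  define D where "D = (\<lambda>p. fst (snd (t p)))"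
  define r where "r = (\<lambda>p. snd (snd (t p)))"
  have CD: "C p \<in> \<A>" "D p \<in> \<B>" "p \<in> chart_dom (C p)" "r p > 0"
    "cball (chart_map (C p) p) (r p) \<subseteq> local_dom (C p) (D p)" if "p \<in> topspace M" for p
    using t[OF that] unfolding Q_def C_def D_def r_def case_prod_beta by blast+
  \<comment> \<open>The closed balls \<open>K p\<close> carry the maxima; the preimages
    \<open>U p\<close> of the open balls form the cover from which a finite part is
    extracted.\<close>
  define K where "K = (\<lambda>p. cball (chart_map (C p) p) (r p))"
  define U where "U = (\<lambda>p. {q \<in> chart_dom (C p). chart_map (C p) q \<in> ball (chart_map (C p) p) (r p)})"
  define \<psi> where "\<psi> = (\<lambda>p y. target_norm (C p) (D p) (fst y) (snd y) / source_norm (C p) (fst y) (snd y))"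
  have Kran: "K p \<subseteq> chart_ran (C p)" if "p \<in> topspace M" for p
    using CD(5)[OF that] unfolding K_def by blast
  have pos: "source_norm (C p) z x > 0" if "p \<in> topspace M" "z \<in> K p" "x \<noteq> 0" for p z x
    using source_norm_pos[OF CD(1)[OF that(1)] _ that(3)] Kran[OF that(1)] that(2) by blast
  have "\<exists>y\<in>K p \<times> S. \<forall>y'\<in>K p \<times> S. \<psi> p y' \<le> \<psi> p y" if p: "p \<in> topspace M" for p
  proof (rule continuous_attains_sup)
    show "compact (K p \<times> S)" unfolding K_def by (intro compact_Times compact_cball S)
    show "K p \<times> S \<noteq> {}" using S(2) CD(4)[OF p] unfolding K_def by simp
    have s: "K p \<times> S \<subseteq> local_dom (C p) (D p) \<times> UNIV" "K p \<times> S \<subseteq> K p \<times> UNIV"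
      using CD(5)[OF p] unfolding K_def by blast+
    have "source_norm (C p) (fst y) (snd y) \<noteq> 0" if "y \<in> K p \<times> S" for y
    proof -
      have "fst y \<in> K p" "snd y \<noteq> 0" using that by (auto simp: S_def)
      from pos[OF p this] show ?thesis by simp
    qed
    then show "continuous_on (K p \<times> S) (\<psi> p)"
      unfolding \<psi>_def
      by (intro continuous_on_divide ballI
          continuous_on_subset[OF continuous_on_target_norm[OF CD(1,2)[OF p]] s(1)]
          continuous_on_subset[OF continuous_on_source_norm[OF CD(1)[OF p] Kran[OF p]] s(2)])
  qed
  then have "\<forall>p\<in>topspace M. \<exists>y. y \<in> K p \<times> S \<and> (\<forall>y'\<in>K p \<times> S. \<psi> p y' \<le> \<psi> p y)"
    unfolding Bex_def by (rule ballI)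
  from bchoice[OF this] obtain Y where
    Y': "\<forall>p\<in>topspace M. Y p \<in> K p \<times> S \<and> (\<forall>y'\<in>K p \<times> S. \<psi> p y' \<le> \<psi> p (Y p))" ..
  then have Y: "Y p \<in> K p \<times> S" "y \<in> K p \<times> S \<Longrightarrow> \<psi> p y \<le> \<psi> p (Y p)" if "p \<in> topspace M" for p y
    using that by blast+
  have oU: "openin M (U p)" if "p \<in> topspace M" for p
    unfolding U_def by (rule is_chart_open_preimage[OF manifold_chart[OF M CD(1)[OF that]] open_ball])
  have "p \<in> U p" if "p \<in> topspace M" for p
    using CD(3,4)[OF that] by (simp add: U_def)
  then have cover: "topspace M \<subseteq> \<Union> (U ` topspace M)" by blast
  have "\<forall>V\<in>U ` topspace M. openin M V" using oU by blast
  with comp cover have "\<exists>\<F>. finite \<F> \<and> \<F> \<subseteq> U ` topspace M \<and> topspace M \<subseteq> \<Union> \<F>"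
    unfolding compact_space_alt by blast
  then obtain \<F> where \<F>: "finite \<F>" "\<F> \<subseteq> U ` topspace M" "topspace M \<subseteq> \<Union> \<F>" by (elim exE conjE)
  obtain P where P: "P \<subseteq> topspace M" "finite P" "\<F> = U ` P"
    using finite_subset_image[OF \<F>(1,2)] by (elim exE conjE)
  then have P: "finite P" "P \<subseteq> topspace M" "topspace M \<subseteq> \<Union> (U ` P)" using \<F>(3) by simp_all
  then have "P \<noteq> {}" using ne by blast
  have "Max ((\<lambda>p. \<psi> p (Y p)) ` P) \<in> (\<lambda>p. \<psi> p (Y p)) ` P"
    by (rule Max_in) (use P(1) \<open>P \<noteq> {}\<close> in auto)
  then obtain p0 where p0: "p0 \<in> P" "Max ((\<lambda>p. \<psi> p (Y p)) ` P) = \<psi> p0 (Y p0)" by blast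
  define m where "m = \<psi> p0 (Y p0)"
  have m: "\<psi> p y \<le> m" if "p \<in> P" "y \<in> K p \<times> S" for p y
  proof -
    have "\<psi> p y \<le> \<psi> p (Y p)" by (rule Y(2)) (use that P(2) in blast)+
    also have "\<dots> \<le> m" unfolding m_def p0(2)[symmetric] by (rule Max_ge) (use P(1) that(1) in auto)
    finally show ?thesis .
  qed
  have p0M: "p0 \<in> topspace M" using p0(1) P(2) by blast
  have Y0: "fst (Y p0) \<in> K p0" "snd (Y p0) \<noteq> 0" using Y(1)[OF p0M] by (auto simp: S_def)
  then have "fst (Y p0) \<in> local_dom (C p0) (D p0)" using CD(5)[OF p0M] by (auto simp: K_def)
  then obtain q0 where q0: "q0 \<in> chart_dom (C p0)" "f q0 \<in> chart_dom (D p0)" "fst (Y p0) = chart_map (C p0) q0"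
    by blast
  have attained: "target_norm (C p0) (D p0) (chart_map (C p0) q0) (snd (Y p0))
      = m * source_norm (C p0) (chart_map (C p0) q0) (snd (Y p0))"
    using pos[OF p0M Y0] unfolding m_def \<psi>_def q0(3) by simp
  have bound: "target_norm c d (chart_map c q) x \<le> m * source_norm c (chart_map c q) x"
    if cd: "c \<in> \<A>" "d \<in> \<B>" "q \<in> chart_dom c" "f q \<in> chart_dom d" for c d q x
  proof -
    have "q \<in> topspace M" by (rule manifold_topspace[OF M cd(1,3)])
    then obtain p where p: "p \<in> P" "q \<in> U p" using P(3) by blast
    have pM: "p \<in> topspace M" using p(1) P(2) by blast
    note Cp = CD(1)[OF pM] and Dp = CD(2)[OF pM]
    have q: "q \<in> chart_dom (C p)" "chart_map (C p) q \<in> K p" using p(2) by (auto simp: U_def K_def)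
    have fq: "f q \<in> chart_dom (D p)"
      using mem_local_dom[OF Cp q(1)] q(2) CD(5)[OF pM] by (auto simp: K_def)
    define z where "z = chart_map (C p) q"
    define x' where "x' = transition_derivative c (C p) q x"
    have zl: "z \<in> local_dom (C p) (D p)" using q(1) fq by (auto simp: z_def)
    have zK: "z \<in> K p" using q(2) by (simp only: z_def)
    have "target_norm (C p) (D p) z x' \<le> m * source_norm (C p) z x'"
    proof (cases "x' = 0")
      \<comment> \<open>The zero vector is no multiple of a point of the sphere; scaling by 0 shows
        that both sides vanish.\<close>
      case True
      then have "x' = 0 *s x'" by simp
      then show ?thesis
        using source_norm_smult[of "C p" z 0 x'] target_norm_smult[OF Cp Dp zl, of 0 x'] by simp
    next
      case False
      define a where "a = complex_of_real (norm x')"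
      define y where "y = (1 / a) *s x'"
      have a: "a \<noteq> 0" using False by (simp add: a_def)
      have xy: "x' = a *s y" using a by (simp add: y_def vec_eq_iff)
      have y: "y \<in> S" "y \<noteq> 0"
        using False by (auto simp: y_def S_def a_def norm_vec_smult norm_divide)
      have "\<psi> p (z, y) \<le> m" by (rule m[OF p(1)]) (use zK y(1) in blast)
      then have "target_norm (C p) (D p) z y \<le> m * source_norm (C p) z y"
        using pos[OF pM zK y(2)] by (simp add: \<psi>_def divide_le_eq)
      then have "(norm a)^2 * target_norm (C p) (D p) z y \<le> (norm a)^2 * (m * source_norm (C p) z y)"
        by (rule mult_left_mono) simp
      then show ?thesis
        unfolding xy source_norm_smult target_norm_smult[OF Cp Dp zl] by (simp only: mult.left_commute)
    qed
    then show ?thesis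
      unfolding z_def x'_def source_norm_transition[OF cd(1) Cp cd(3) q(1)]
        target_norm_transition[OF cd(1) Cp cd(2) Dp cd(3) q(1) cd(4) fq] .
  qed
  show ?thesis
    by (rule that[OF CD(1,2)[OF p0M] q0(1,2) Y0(2) attained bound])
qed

lemma constant_if_curvature:
  assumes comp: "compact_space M" and nonpos: "nonpos_bisectional_curvature \<B> h"
    and RC: "\<And>c q v. c \<in> \<A> \<Longrightarrow> q \<in> chart_dom c \<Longrightarrow> v \<in> hol_tangent_space \<A> q \<Longrightarrow> v \<noteq> (\<lambda>d. 0) \<Longrightarrow>
      \<exists>u\<in>hol_tangent_space \<A> q. Re (chern_curvature \<A> g c q u v) > 0"
  shows "f constant_on topspace M"
proof (cases "topspace M = {}")
  \<comment> \<open>With no points in \<open>M\<close> there is no maximum to take, and the claim is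
    vacuous.\<close>
  case True
  then show ?thesis unfolding constant_on_def by blast
next
  case False
  obtain m c d q x where cd: "c \<in> \<A>" "d \<in> \<B>" "q \<in> chart_dom c" "f q \<in> chart_dom d" and x: "x \<noteq> 0"
    and eq: "target_norm c d (chart_map c q) x = m * source_norm c (chart_map c q) x"
    and le: "\<And>c d q x. c \<in> \<A> \<Longrightarrow> d \<in> \<B> \<Longrightarrow> q \<in> chart_dom c \<Longrightarrow> f q \<in> chart_dom d \<Longrightarrow>
       target_norm c d (chart_map c q) x \<le> m * source_norm c (chart_map c q) x"
    by (rule target_norm_le_maximum[OF False comp], rule that)
  let ?z = "chart_map c q" and ?H = "metric_matrix \<B> h d" and ?G = "metric_matrix \<A> g c"
  let ?y = "local_derivative c d q"
  obtain u where u: "u \<in> hol_tangent_space \<A> q" "Re (chern_curvature \<A> g c q u (tvec_of \<A> c q x)) > 0"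
    using RC[OF cd(1,3) tvec_of_in_tangent_space[OF M cd(1,3)]] tvec_of_eq_zero_iff[OF M cd(1,3)] x by blast
  have posc: "Re (chern_form ?G ?z (u c) x) > 0"
    using u(2) unfolding chern_curvature_eq_chern_form tvec_of_component[OF M cd(1,3)] .
  have "m * Re (chern_form ?G ?z (u c) x) \<le> Re (chern_form ?H (local_rep c d ?z) (?y (u c)) (?y x))"
  proof (rule chern_form_le_of_maximum)
    show "local_metric ?G (local_dom c d)"
      by (rule local_metric_subset[OF local_metric_metric_matrix[OF M g cd(1)] _ local_dom_open[OF cd(1,2)]]) blast
    show "local_metric ?H (chart_ran d)" by (rule local_metric_metric_matrix[OF N h cd(2)])
    show "mv_holomorphic_on (local_rep c d) (local_dom c d)" by (rule local_rep_holomorphic[OF cd(1,2)])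
    show "local_rep c d ` local_dom c d \<subseteq> chart_ran d"
      using local_rep_chart_map[OF cd(1)] by (auto simp del: comp_apply)
    show "?z \<in> local_dom c d" using cd by blast
    show "Re (hform (?H (local_rep c d z)) (frechet_derivative (local_rep c d) (at z) x) (frechet_derivative (local_rep c d) (at z) x))
        \<le> m * Re (hform (?G z) x x)" if z: "z \<in> local_dom c d" for z x
    proof -
      obtain p where p: "p \<in> chart_dom c" "f p \<in> chart_dom d" "z = chart_map c p" using z by blast
      show ?thesis using le[OF cd(1,2) p(1,2)] unfolding target_norm_def source_norm_def p(3) .
    qed
    show "Re (hform (?H (local_rep c d ?z)) (?y x) (?y x)) = m * Re (hform (?G ?z) x x)"
      using eq unfolding target_norm_def source_norm_def .
  qed
  \<comment> \<open>The curvature condition on \<open>N\<close> speaks of tangent vectors, so the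
    coordinate images of \<open>u\<close> and \<open>x\<close> are turned into such vectors at
    \<open>f q\<close>.\<close>
  also have "\<dots> = Re (chern_curvature \<B> h d (f q) (tvec_of \<B> d (f q) (?y (u c))) (tvec_of \<B> d (f q) (?y x)))"
    unfolding chern_curvature_eq_chern_form tvec_of_component[OF N cd(2,4)] local_rep_chart_map[OF cd(1,3)] ..
  also have "\<dots> \<le> 0"
    using nonpos cd(2,4) tvec_of_in_tangent_space[OF N cd(2,4)] unfolding nonpos_bisectional_curvature_def by blast
  finally have m: "m \<le> 0" using posc by (simp add: mult_le_0_iff)
  show ?thesis
  proof (rule constant_if_derivative_zero, rule ccontr)
    fix c d q x
    assume cd: "c \<in> \<A>" "d \<in> \<B>" "q \<in> chart_dom c" "f q \<in> chart_dom d" and ne: "local_derivative c d q x \<noteq> 0"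
    have "source_norm c (chart_map c q) x \<ge> 0"
      unfolding source_norm_def
      by (rule local_metric_nonneg[OF local_metric_metric_matrix[OF M g cd(1)]]) (use cd(3) in blast)
    then have "target_norm c d (chart_map c q) x \<le> 0"
      using le[OF cd, of x] m by (meson mult_nonpos_nonneg order_trans)
    \<comment> \<open>\<open>h\<close> is positive definite, so a nonzero image vector has positive
      squared length, against the upper bound 0 just obtained.\<close>
    moreover have "target_norm c d (chart_map c q) x > 0"
      unfolding target_norm_def local_rep_chart_map[OF cd(1,3)]
      by (rule local_metricD(4)[OF local_metric_metric_matrix[OF N h cd(2)] _ ne]) (use cd(4) in blast)
    ultimately show False by simp
  qed
qed

end

theorem corollary1p4:
  fixes M :: "'a topology" and \<A> :: "('a, 'm::finite) chart set"
    and N :: "'b topology" and \<B> :: "('b, 'n::finite) chart set"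
    and h :: "('b, 'n) metric" and f :: "'a \<Rightarrow> 'b"
  assumes "complex_manifold M \<A>" and "compact_space M"
    and "RC_positive_tangent_bundle M \<A>"
    and "complex_manifold N \<B>" and "hermitian_metric N \<B> h"
    and "nonpos_bisectional_curvature \<B> h"
    and "holomorphic_map M \<A> N \<B> f"
  shows "f constant_on topspace M"
proof -
  obtain g where g: "hermitian_metric M \<A> g"
    and RC: "\<And>c q v. c \<in> \<A> \<Longrightarrow> q \<in> chart_dom c \<Longrightarrow> v \<in> hol_tangent_space \<A> q \<Longrightarrow> v \<noteq> (\<lambda>d. 0) \<Longrightarrow>
      \<exists>u\<in>hol_tangent_space \<A> q. Re (chern_curvature \<A> g c q u v) > 0"
    using assms(3) unfolding RC_positive_tangent_bundle_def by blast
  interpret holomorphic_map_metrics M \<A> N \<B> f g h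
    by unfold_locales (rule assms g)+
  show ?thesis by (rule constant_if_curvature[OF assms(2,6) RC])
qed

end
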